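(* Let $X$ be a complex manifold and let $\theta,\psi\in C^\infty_{0,1}(X,T^{1,0}X)$. The following identities of operators on $\mathbb{C}$-valued differential forms hold: (1) $[L_\theta,\bar\partial]=-[(\bar\partial\theta)\lrcorner\cdot\,,\partial]$; in particular, $L_\theta\bar\partial=-\bar\partial L_\theta$ when $\bar\partial\theta=0$; (2) $L_\theta\partial=-\partial L_\theta$; (3) $L_\theta(u\wedge v)=L_\theta(u)\wedge v+(-1)^{\deg u}\,u\wedge L_\theta(v)$ for all forms $u,v$; (4) $[\theta\lrcorner\cdot\,,L_\psi]=-[L_\theta,\psi\lrcorner\cdot\,]=[\theta,\psi]\lrcorner\cdot$; (5) $[L_\theta,L_\psi]=L_{[\theta,\psi]}$.
   Context: $C^\infty_{p,q}(X,\mathbb{C})$ denotes smooth $(p,q)$-forms and $C^\infty_{0,s}(X,T^{1,0}X)$ smooth $(0,s)$-forms with values in the holomorphic tangent bundle, on which $\bar\partial$ is the canonical operator. Contraction: for $\theta\in C^\infty_{0,s}(X,T^{1,0}X)$ locally written $\theta=\sum_k\theta^k\frac{\partial}{\partial z_k}$ with $(0,s)$-forms $\theta^k$, $\theta\lrcorner u:=\sum_k\theta^k\wedge\big(\frac{\partial}{\partial z_k}\lrcorner u\big)$; the operator $\theta\lrcorner\cdot$ has degree $s-1$. Operator brackets are graded commutators: $[A,B]=AB-(-1)^{ab}BA$ for operators $A,B$ on forms of degrees $a,b$. Lie derivative: for $\theta\in C^\infty_{0,s}(X,T^{1,0}X)$, $L_\theta:=[\partial,\theta\lrcorner\cdot\,]$,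 i.e. $\partial(\theta\lrcorner u)=L_\theta u+(-1)^{s+1}\theta\lrcorner\partial u$; it has degree $s$. Lie bracket of vector-valued forms: for $\varphi=\sum_\lambda\varphi^\lambda\frac{\partial}{\partial z_\lambda}\in C^\infty_{0,a}(X,T^{1,0}X)$ and $\psi=\sum_\lambda\psi^\lambda\frac{\partial}{\partial z_\lambda}\in C^\infty_{0,b}(X,T^{1,0}X)$, $[\varphi,\psi]:=\sum_{\lambda,\mu}\big(\varphi^\mu\wedge\frac{\partial\psi^\lambda}{\partial z_\mu}-(-1)^{ab}\psi^\mu\wedge\frac{\partial\varphi^\lambda}{\partial z_\mu}\big)\frac{\partial}{\partial z_\lambda}\in C^\infty_{0,a+b}(X,T^{1,0}X)$. *)

theory Defs
  imports "HOL-Analysis.Analysis" "HOL-Library.Function_Algebras"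
begin

section \<open>Complex manifolds\<close>

text \<open>\<open>C\<^sup>\<infinity>\<close> maps on an open set: all iterated directional derivatives exist, are differentiable
  and continuous.\<close>

primrec Ck_on :: "nat \<Rightarrow> 'a::euclidean_space set \<Rightarrow> ('a \<Rightarrow> 'b::real_normed_vector) \<Rightarrow> bool" where
  "Ck_on 0 S f \<longleftrightarrow> continuous_on S f"
| "Ck_on (Suc k) S f \<longleftrightarrow>
     (\<forall>x\<in>S. f differentiable (at x)) \<and> (\<forall>v. Ck_on k S (\<lambda>x. frechet_derivative f (at x) v))"

definition smooth_on :: "'a::euclidean_space set \<Rightarrow> ('a \<Rightarrow> 'b::real_normed_vector) \<Rightarrow> bool" where
  "smooth_on S f \<longleftrightarrow> (\<forall>k. Ck_on k S f)"

definition holo_on :: "(complex^'n) set \<Rightarrow> (complex^'n \<Rightarrow> complex^'n) \<Rightarrow> bool" where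
  "holo_on S f \<longleftrightarrow>
     (\<forall>x\<in>S. \<exists>D. (f has_derivative D) (at x) \<and> (\<forall>a v. D (a *s v) = a *s D v))"

text \<open>A chart is a pair of its domain and a coordinate map; values of the coordinate map outside
  the domain are irrelevant.\<close>

type_synonym ('a, 'n) chart = "'a set \<times> ('a \<Rightarrow> complex^'n)"

definition cimage :: "('a, 'n) chart \<Rightarrow> (complex^'n) set" where
  "cimage c = snd c ` fst c"

definition transition :: "('a, 'n) chart \<Rightarrow> ('a, 'n) chart \<Rightarrow> complex^'n \<Rightarrow> complex^'n" where
  "transition c d = snd d \<circ> inv_into (fst c) (snd c)"

definition complex_manifold :: "'a topology \<Rightarrow> ('a, 'n::finite) chart set \<Rightarrow> bool" where
  "complex_manifold X A \<longleftrightarrow>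
     Hausdorff_space X \<and> second_countable X \<and>
     (\<Union>c\<in>A. fst c) = topspace X \<and>
     (\<forall>c\<in>A. openin X (fst c) \<and> open (cimage c) \<and>
        homeomorphic_map (subtopology X (fst c)) (top_of_set (cimage c)) (snd c)) \<and>
     (\<forall>c\<in>A. \<forall>d\<in>A. holo_on (snd c ` (fst c \<inter> fst d)) (transition c d))"


section \<open>Exterior algebra at a point\<close>

text \<open>An element of the full exterior algebra of complex-valued real-multilinear forms on
  \<open>\<complex>\<^sup>n\<close>: its degree \<open>k\<close> part is the restriction to argument lists of length \<open>k\<close>.\<close>

type_synonym 'n aform = "(complex^'n) list \<Rightarrow> complex"

definition alternating :: "'n::finite aform \<Rightarrow> bool" where
  "alternating w \<longleftrightarrow>
     (\<forall>xs ys. linear (\<lambda>v. w (xs @ v # ys))) \<and> (\<forall>vs. \<not> distinct vs \<longrightarrow> w vs = 0)"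

text \<open>Sum over shuffles (determinant convention): the arguments at the positions in \<open>I\<close> go to
  \<open>u\<close>, the others to \<open>v\<close>; the exponent counts the inversions of the shuffle.\<close>

definition wedge :: "'n::finite aform \<Rightarrow> 'n aform \<Rightarrow> 'n aform" where
  "wedge u v = (\<lambda>vs. \<Sum>I\<in>Pow {..<length vs}.
     (-1) ^ card {(i, j). i \<in> I \<and> j \<in> {..<length vs} - I \<and> j < i} * u (nths vs I) * v (nths vs (- I)))"

definition one_form0 :: "'n::finite aform" where
  "one_form0 vs = (if vs = [] then 1 else 0)"

definition dz :: "'n::finite \<Rightarrow> 'n aform" where
  "dz j vs = (case vs of [v] \<Rightarrow> v $ j | _ \<Rightarrow> 0)"

definition dzbar :: "'n::finite \<Rightarrow> 'n aform" where
  "dzbar j vs = (case vs of [v] \<Rightarrow> cnj (v $ j) | _ \<Rightarrow> 0)"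

text \<open>The span of the forms \<open>dz\<^sub>I \<and> dzbar\<^sub>J\<close> with \<open>|I| = p\<close> and \<open>|J| = q\<close>.\<close>

definition pq_type :: "nat \<Rightarrow> nat \<Rightarrow> 'n::finite aform \<Rightarrow> bool" where
  "pq_type p q w \<longleftrightarrow> (\<exists>a. w = (\<lambda>vs.
     \<Sum>I | length I = p. \<Sum>J | length J = q.
       a I J * foldr wedge (map dz I @ map dzbar J) one_form0 vs))"

text \<open>Interior product with \<open>\<partial>/\<partial>z\<^sub>k = (\<partial>/\<partial>x\<^sub>k - i \<partial>/\<partial>y\<^sub>k) / 2\<close>, where forms are extended complex-linearly
  to the complexified tangent space.\<close>

definition int_dz :: "'n::finite \<Rightarrow> 'n aform \<Rightarrow> 'n aform" where
  "int_dz k w = (\<lambda>vs. (w (axis k 1 # vs) - \<i> * w (axis k \<i> # vs)) / 2)"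

definition wirt :: "'n::finite \<Rightarrow> (complex^'n \<Rightarrow> complex) \<Rightarrow> complex^'n \<Rightarrow> complex" where
  "wirt j f z = (frechet_derivative f (at z) (axis j 1) - \<i> * frechet_derivative f (at z) (axis j \<i>)) / 2"

definition wirtbar :: "'n::finite \<Rightarrow> (complex^'n \<Rightarrow> complex) \<Rightarrow> complex^'n \<Rightarrow> complex" where
  "wirtbar j f z = (frechet_derivative f (at z) (axis j 1) + \<i> * frechet_derivative f (at z) (axis j \<i>)) / 2"


section \<open>Differential forms on a complex manifold\<close>

text \<open>Global forms are families of local expressions, one on each coordinate image, related by
  pullback under the transition maps. They are set to 0 off the atlas and off the coordinate images,
  so that equality of forms is equality of functions. Forms need not be homogeneous.\<close>

type_synonym ('a, 'n) gform = "('a, 'n) chart \<Rightarrow> complex^'n \<Rightarrow> 'n aform"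

definition forms :: "('a, 'n::finite) chart set \<Rightarrow> ('a, 'n) gform set" where
  "forms A = {u.
     (\<forall>c z. \<not> (c \<in> A \<and> z \<in> cimage c) \<longrightarrow> u c z = 0) \<and>
     (\<forall>c\<in>A. \<forall>z\<in>cimage c. alternating (u c z)) \<and>
     (\<forall>c\<in>A. \<forall>vs. smooth_on (cimage c) (\<lambda>z. u c z vs)) \<and>
     (\<forall>c\<in>A. \<forall>d\<in>A. \<forall>x\<in>fst c \<inter> fst d. \<forall>vs.
        u c (snd c x) vs =
        u d (snd d x) (map (frechet_derivative (transition c d) (at (snd c x))) vs))}"

definition has_degree :: "nat \<Rightarrow> ('a, 'n::finite) gform \<Rightarrow> bool" where
  "has_degree k u \<longleftrightarrow> (\<forall>c z vs. length vs \<noteq> k \<longrightarrow> u c z vs = 0)"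

text \<open>Forms with values in \<open>T\<^sup>1\<^sup>,\<^sup>0X\<close>, trivialised in each chart by the frame \<open>\<partial>/\<partial>z\<^sub>k\<close>: the \<open>k\<close>-th
  component of the value is \<open>\<theta>\<^sup>k\<close>. The frame changes by the (complex-linear) derivative of the
  transition map.\<close>

type_synonym ('a, 'n) tform = "('a, 'n) chart \<Rightarrow> complex^'n \<Rightarrow> (complex^'n) list \<Rightarrow> complex^'n"

definition tcomp :: "('a, 'n::finite) tform \<Rightarrow> 'n \<Rightarrow> ('a, 'n) gform" where
  "tcomp \<theta> k = (\<lambda>c z vs. \<theta> c z vs $ k)"

definition tforms :: "('a, 'n::finite) chart set \<Rightarrow> nat \<Rightarrow> ('a, 'n) tform set" where
  "tforms A s = {\<theta>.
     (\<forall>c z. \<not> (c \<in> A \<and> z \<in> cimage c) \<longrightarrow> \<theta> c z = 0) \<and>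
     (\<forall>c\<in>A. \<forall>z\<in>cimage c. \<forall>k. pq_type 0 s (tcomp \<theta> k c z)) \<and>
     (\<forall>c\<in>A. \<forall>vs. smooth_on (cimage c) (\<lambda>z. \<theta> c z vs)) \<and>
     (\<forall>c\<in>A. \<forall>d\<in>A. \<forall>x\<in>fst c \<inter> fst d. \<forall>vs.
        let D = frechet_derivative (transition c d) (at (snd c x))
        in D (\<theta> c (snd c x) vs) = \<theta> d (snd d x) (map D vs))}"


section \<open>Operators\<close>

definition gscale :: "complex \<Rightarrow> ('a, 'n::finite) gform \<Rightarrow> ('a, 'n) gform" where
  "gscale a u = (\<lambda>c z vs. a * u c z vs)"

definition gwedge :: "('a, 'n::finite) gform \<Rightarrow> ('a, 'n) gform \<Rightarrow> ('a, 'n) gform" where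
  "gwedge u v = (\<lambda>c z. wedge (u c z) (v c z))"

text \<open>Coefficientwise \<open>\<partial>u/\<partial>z\<^sub>j\<close> and \<open>\<partial>u/\<partial>zbar\<^sub>j\<close> in each chart: evaluating on constant vectors gives the
  coefficients with respect to the coordinate coframe.\<close>

definition ddz :: "('a, 'n::finite) chart set \<Rightarrow> 'n \<Rightarrow> ('a, 'n) gform \<Rightarrow> ('a, 'n) gform" where
  "ddz A j u = (\<lambda>c z vs. if c \<in> A \<and> z \<in> cimage c then wirt j (\<lambda>w. u c w vs) z else 0)"

definition ddzbar :: "('a, 'n::finite) chart set \<Rightarrow> 'n \<Rightarrow> ('a, 'n) gform \<Rightarrow> ('a, 'n) gform" where
  "ddzbar A j u = (\<lambda>c z vs. if c \<in> A \<and> z \<in> cimage c then wirtbar j (\<lambda>w. u c w vs) z else 0)"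

definition del :: "('a, 'n::finite) chart set \<Rightarrow> ('a, 'n) gform \<Rightarrow> ('a, 'n) gform" where
  "del A u = (\<lambda>c z. \<Sum>j\<in>UNIV. wedge (dz j) (ddz A j u c z))"

definition delbar :: "('a, 'n::finite) chart set \<Rightarrow> ('a, 'n) gform \<Rightarrow> ('a, 'n) gform" where
  "delbar A u = (\<lambda>c z. \<Sum>j\<in>UNIV. wedge (dzbar j) (ddzbar A j u c z))"

definition delbarT :: "('a, 'n::finite) chart set \<Rightarrow> ('a, 'n) tform \<Rightarrow> ('a, 'n) tform" where
  "delbarT A \<theta> = (\<lambda>c z vs. \<chi> k. delbar A (tcomp \<theta> k) c z vs)"

definition contr :: "('a, 'n::finite) tform \<Rightarrow> ('a, 'n) gform \<Rightarrow> ('a, 'n) gform" where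
  "contr \<theta> u = (\<lambda>c z. \<Sum>k\<in>UNIV. wedge (tcomp \<theta> k c z) (int_dz k (u c z)))"

text \<open>Graded commutator of operators \<open>P\<close>, \<open>Q\<close> of degrees \<open>a\<close>, \<open>b\<close>. Degrees are integers because
  contraction with a vector-valued \<open>(0,0)\<close>-form has degree -1.\<close>

definition gcomm :: "int \<Rightarrow> (('a, 'n::finite) gform \<Rightarrow> ('a, 'n) gform) \<Rightarrow>
    int \<Rightarrow> (('a, 'n) gform \<Rightarrow> ('a, 'n) gform) \<Rightarrow> ('a, 'n) gform \<Rightarrow> ('a, 'n) gform" where
  "gcomm a P b Q u = P (Q u) - gscale ((-1) powi (a * b)) (Q (P u))"

definition lie :: "('a, 'n::finite) chart set \<Rightarrow> nat \<Rightarrow> ('a, 'n) tform \<Rightarrow> ('a, 'n) gform \<Rightarrow> ('a, 'n) gform" where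
  "lie A s \<theta> = gcomm 1 (del A) (int s - 1) (contr \<theta>)"

definition bracket :: "('a, 'n::finite) chart set \<Rightarrow> nat \<Rightarrow> nat \<Rightarrow>
    ('a, 'n) tform \<Rightarrow> ('a, 'n) tform \<Rightarrow> ('a, 'n) tform" where
  "bracket A a b \<phi> \<psi> = (\<lambda>c z vs. \<chi> l. \<Sum>m\<in>UNIV.
     gwedge (tcomp \<phi> m) (ddz A m (tcomp \<psi> l)) c z vs
     - (-1) ^ (a * b) * gwedge (tcomp \<psi> m) (ddz A m (tcomp \<phi> l)) c z vs)"

end

theory Submission
  imports Defs
begin

text \<open>All operators act chart by chart, so the identities can be checked on the open sets
  \<open>cimage c\<close>. Write \<open>D\<^sub>k\<close> for \<open>\<partial>/\<partial>z\<^sub>k\<close> acting on coefficients and \<open>i\<^sub>k\<close> for the interior product. The Leibniz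
  rule for \<open>\<partial>\<close> together with \<open>i\<^sub>k \<partial> = D\<^sub>k - \<partial> i\<^sub>k\<close> gives
  \<open>L\<^sub>\<psi> u = \<Sum>\<^sub>k (\<partial>\<psi>\<^sup>k \<and> i\<^sub>k u - \<psi>\<^sup>k \<and> D\<^sub>k u)\<close>. This shows (3), and, since the \<open>i\<^sub>k\<close> anticommute on alternating forms,
  \<open>i\<^sub>m L\<^sub>\<psi> u + L\<^sub>\<psi> i\<^sub>m u = \<Sum>\<^sub>k D\<^sub>m \<psi>\<^sup>k \<and> i\<^sub>k u\<close>, whence (4). The rest is formal: (1) follows from
  \<open>[\<partial>bar, \<theta>] = \<partial>bar \<theta>\<close> (as contractions) and \<open>\<partial> \<partial>bar = - \<partial>bar \<partial>\<close>, (2) from \<open>\<partial>\<partial> = 0\<close>, and (5) from (2) and (4).\<close>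

section \<open>Smooth functions\<close>

text \<open>Openness makes the derivative at a point of \<open>S\<close> depend only on values in
  \<open>S\<close>. The closure lemmas use this to replace the derivative of a compound by its
  formula, which is known on \<open>S\<close> only.\<close>

lemma Ck_on_cong:
  assumes "open S" "\<And>x. x \<in> S \<Longrightarrow> f x = g x" "Ck_on k S f"
  shows "Ck_on k S g"
  using assms(2,3)
proof (induction k arbitrary: f g)
  case 0
  then show ?case by (simp cong: continuous_on_cong)
next
  case (Suc k)
  have d: "g differentiable (at x)" and e: "frechet_derivative f (at x) = frechet_derivative g (at x)"
    if "x \<in> S" for x
  proof -
    have fx: "f differentiable (at x)" using Suc.prems that by simp
    then show "g differentiable (at x)"
      unfolding differentiable_def
      using has_derivative_transform_within_open[OF _ \<open>open S\<close> that] Suc.prems(1) by blast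
    show "frechet_derivative f (at x) = frechet_derivative g (at x)"
      by (rule frechet_derivative_transform_within_open[OF fx \<open>open S\<close> that]) (use Suc.prems in auto)
  qed
  have "Ck_on k S (\<lambda>x. frechet_derivative g (at x) v)" for v
    by (rule Suc.IH[of "\<lambda>x. frechet_derivative f (at x) v"]) (use e Suc.prems in auto)
  then show ?case using d by simp
qed

lemma Ck_on_SucD: "Ck_on (Suc k) S f \<Longrightarrow> Ck_on k S f"
proof (induction k arbitrary: f)
  case 0
  then show ?case
    by (auto intro!: continuous_at_imp_continuous_on differentiable_imp_continuous_within)
next
  case (Suc k)
  then show ?case by (metis Ck_on.simps(2))
qed

lemma Ck_on_bounded_linear:
  assumes "open S" "bounded_linear L" "Ck_on k S f"
  shows "Ck_on k S (\<lambda>x. L (f x))"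
  using assms(3)
proof (induction k arbitrary: f)
  case 0
  then show ?case using bounded_linear.continuous_on[OF assms(2)] by simp
next
  case (Suc k)
  have d: "((\<lambda>x. L (f x)) has_derivative (\<lambda>v. L (frechet_derivative f (at x) v))) (at x)" if "x \<in> S" for x
  proof -
    have "(f has_derivative frechet_derivative f (at x)) (at x)"
      using Suc.prems that frechet_derivative_works by auto
    then show ?thesis by (rule bounded_linear.has_derivative[OF assms(2)])
  qed
  have "Ck_on k S (\<lambda>x. frechet_derivative (\<lambda>x. L (f x)) (at x) v)" for v
    by (rule Ck_on_cong[OF assms(1) _ Suc.IH[of "\<lambda>x. frechet_derivative f (at x) v"]])
       (use Suc.prems in \<open>auto simp flip: frechet_derivative_at[OF d]\<close>)
  then show ?case using d by (auto simp: differentiable_def)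
qed

lemma Ck_on_add:
  assumes "open S" "Ck_on k S f" "Ck_on k S g"
  shows "Ck_on k S (\<lambda>x. f x + g x)"
  using assms(2,3)
proof (induction k arbitrary: f g)
  case 0
  then show ?case by (simp add: continuous_on_add)
next
  case (Suc k)
  have d: "((\<lambda>x. f x + g x) has_derivative
      (\<lambda>v. frechet_derivative f (at x) v + frechet_derivative g (at x) v)) (at x)" if "x \<in> S" for x
    using Suc.prems that frechet_derivative_works by (intro has_derivative_add) auto
  have "Ck_on k S (\<lambda>x. frechet_derivative (\<lambda>x. f x + g x) (at x) v)" for v
    by (rule Ck_on_cong[OF assms(1) _ Suc.IH[of "\<lambda>x. frechet_derivative f (at x) v"
            "\<lambda>x. frechet_derivative g (at x) v"]])
       (use Suc.prems in \<open>auto simp flip: frechet_derivative_at[OF d]\<close>)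
  then show ?case using d by (auto simp: differentiable_def)
qed

lemma Ck_on_mult:
  fixes f g :: "'a::euclidean_space \<Rightarrow> 'b::real_normed_algebra"
  assumes "open S" "Ck_on k S f" "Ck_on k S g"
  shows "Ck_on k S (\<lambda>x. f x * g x)"
  using assms(2,3)
proof (induction k arbitrary: f g)
  case 0
  then show ?case by (simp add: continuous_on_mult)
next
  case (Suc k)
  have d: "((\<lambda>x. f x * g x) has_derivative
      (\<lambda>v. f x * frechet_derivative g (at x) v + frechet_derivative f (at x) v * g x)) (at x)" if "x \<in> S" for x
    using Suc.prems that frechet_derivative_works by (intro has_derivative_mult) auto
  \<comment> \<open>Each term of the product rule contains an undifferentiated factor, so the
    induction hypothesis is also needed for \<open>f\<close> and \<open>g\<close>
    themselves.\<close>
  have c: "Ck_on k S f" "Ck_on k S g" using Suc.prems Ck_on_SucD by blast+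
  have "Ck_on k S (\<lambda>x. frechet_derivative (\<lambda>x. f x * g x) (at x) v)" for v
    by (rule Ck_on_cong[OF assms(1) _ Ck_on_add[OF assms(1) Suc.IH[of f "\<lambda>x. frechet_derivative g (at x) v"]
            Suc.IH[of "\<lambda>x. frechet_derivative f (at x) v" g]]])
       (use c Suc.prems in \<open>auto simp flip: frechet_derivative_at[OF d]\<close>)
  then show ?case using d by (auto simp: differentiable_def)
qed

lemma smooth_on_differentiable: "smooth_on S f \<Longrightarrow> x \<in> S \<Longrightarrow> f differentiable (at x)"
  unfolding smooth_on_def by (metis Ck_on.simps(2))

lemma smooth_on_frechet_derivative:
  "smooth_on S f \<Longrightarrow> smooth_on S (\<lambda>x. frechet_derivative f (at x) v)"
  unfolding smooth_on_def by (metis Ck_on.simps(2))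

lemma smooth_on_imp_continuous_on: "smooth_on S f \<Longrightarrow> continuous_on S f"
  unfolding smooth_on_def by (metis Ck_on.simps(1))

lemma smooth_on_cong:
  "open S \<Longrightarrow> (\<And>x. x \<in> S \<Longrightarrow> f x = g x) \<Longrightarrow> smooth_on S f \<Longrightarrow> smooth_on S g"
  unfolding smooth_on_def by (blast intro: Ck_on_cong)

lemma smooth_on_bounded_linear:
  "open S \<Longrightarrow> bounded_linear L \<Longrightarrow> smooth_on S f \<Longrightarrow> smooth_on S (\<lambda>x. L (f x))"
  unfolding smooth_on_def by (blast intro: Ck_on_bounded_linear)

lemma smooth_on_add: "open S \<Longrightarrow> smooth_on S f \<Longrightarrow> smooth_on S g \<Longrightarrow> smooth_on S (\<lambda>x. f x + g x)"
  unfolding smooth_on_def by (blast intro: Ck_on_add)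

lemma smooth_on_mult:
  fixes f g :: "'a::euclidean_space \<Rightarrow> 'b::real_normed_algebra"
  shows "open S \<Longrightarrow> smooth_on S f \<Longrightarrow> smooth_on S g \<Longrightarrow> smooth_on S (\<lambda>x. f x * g x)"
  unfolding smooth_on_def by (blast intro: Ck_on_mult)

lemma smooth_on_const: "smooth_on S (\<lambda>x. c)"
proof -
  have "Ck_on k S (\<lambda>x. c)" for k
    by (induction k arbitrary: c) auto
  then show ?thesis by (simp add: smooth_on_def)
qed

lemma smooth_on_sum:
  "open S \<Longrightarrow> (\<And>i. i \<in> I \<Longrightarrow> smooth_on S (f i)) \<Longrightarrow> smooth_on S (\<lambda>x. \<Sum>i\<in>I. f i x)"
  by (induction I rule: infinite_finite_induct) (auto intro: smooth_on_const smooth_on_add)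

section \<open>Symmetry of second derivatives\<close>

lemma second_difference_mean_value:
  fixes f :: "'a::euclidean_space \<Rightarrow> real"
  assumes h: "h > 0"
    and S: "\<And>s t. 0 \<le> s \<Longrightarrow> s \<le> h \<Longrightarrow> 0 \<le> t \<Longrightarrow> t \<le> h \<Longrightarrow> z + s *\<^sub>R v + t *\<^sub>R w \<in> S"
    and f: "\<And>x. x \<in> S \<Longrightarrow> f differentiable (at x)"
    and f': "\<And>x. x \<in> S \<Longrightarrow> (\<lambda>x. frechet_derivative f (at x) v) differentiable (at x)"
  obtains s t where "0 \<le> s" "s \<le> h" "0 \<le> t" "t \<le> h"
    "f (z + h *\<^sub>R v + h *\<^sub>R w) - f (z + h *\<^sub>R v) - f (z + h *\<^sub>R w) + f z =
     h * (h * frechet_derivative (\<lambda>x. frechet_derivative f (at x) v) (at (z + s *\<^sub>R v + t *\<^sub>R w)) w)"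
proof -
  have ray: "((\<lambda>r. g (a + r *\<^sub>R b)) has_derivative (\<lambda>y. frechet_derivative g (at (a + r *\<^sub>R b)) (y *\<^sub>R b)))
      (at r within T)"
    if "g differentiable (at (a + r *\<^sub>R b))" for g :: "'a \<Rightarrow> real" and a b r T
  proof -
    have "(g has_derivative frechet_derivative g (at (a + r *\<^sub>R b))) (at (a + r *\<^sub>R b))"
      using that frechet_derivative_works by blast
    then have g: "(g has_derivative frechet_derivative g (at (a + r *\<^sub>R b)))
        (at (a + r *\<^sub>R b) within (\<lambda>r. a + r *\<^sub>R b) ` T)"
      by (rule has_derivative_at_withinI)
    have "((\<lambda>r. a + r *\<^sub>R b) has_derivative (\<lambda>y. y *\<^sub>R b)) (at r within T)"
      by (auto intro!: derivative_eq_intros)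
    from diff_chain_within[OF this g] show ?thesis by (simp add: o_def)
  qed
  have lin: "frechet_derivative g (at x) (y *\<^sub>R b) = y * frechet_derivative g (at x) b"
    if "g differentiable (at x)" for g :: "'a \<Rightarrow> real" and x y b
    using linear_cmul[OF linear_frechet_derivative[OF that]] by simp
  have S0: "z + s *\<^sub>R v \<in> S" if "0 \<le> s" "s \<le> h" for s
    using S[OF that, of 0] h by simp
  \<comment> \<open>\<open>g h - g 0\<close> is the second difference of \<open>f\<close> over the
    parallelogram with sides \<open>h\<close> times \<open>v\<close> and \<open>h\<close> times
    \<open>w\<close>. The mean value theorem along \<open>v\<close> turns it into \<open>h\<close>
    times a difference of first derivatives, and a second application along \<open>w\<close>
    produces the mixed derivative.\<close>
  define g where "g s = f ((z + h *\<^sub>R w) + s *\<^sub>R v) - f (z + s *\<^sub>R v)" for s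
  have in2: "(z + h *\<^sub>R w) + s *\<^sub>R v \<in> S" if "0 \<le> s" "s \<le> h" for s
    using S[OF that, of h] h by (simp add: algebra_simps)
  have "\<exists>s\<in>{0<..<h}. g h - g 0 = (\<lambda>y. frechet_derivative f (at ((z + h *\<^sub>R w) + s *\<^sub>R v)) (y *\<^sub>R v)
      - frechet_derivative f (at (z + s *\<^sub>R v)) (y *\<^sub>R v)) (h - 0)"
    unfolding g_def
    by (rule mvt_simple[OF h]) (auto intro!: has_derivative_diff ray f in2 S0)
  then obtain s where s: "0 < s" "s < h" and gs: "g h - g 0 =
      frechet_derivative f (at ((z + h *\<^sub>R w) + s *\<^sub>R v)) (h *\<^sub>R v) - frechet_derivative f (at (z + s *\<^sub>R v)) (h *\<^sub>R v)"
    by auto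
  let ?k = "\<lambda>x. frechet_derivative f (at x) v"
  have "\<exists>t\<in>{0<..<h}. ?k ((z + s *\<^sub>R v) + h *\<^sub>R w) - ?k ((z + s *\<^sub>R v) + 0 *\<^sub>R w) =
     (\<lambda>y. frechet_derivative ?k (at ((z + s *\<^sub>R v) + t *\<^sub>R w)) (y *\<^sub>R w)) (h - 0)"
    by (rule mvt_simple[OF h, where f = "\<lambda>t. ?k ((z + s *\<^sub>R v) + t *\<^sub>R w)"]) (use s in \<open>auto intro!: ray f' S\<close>)
  then obtain t where t: "0 < t" "t < h" and kt: "?k ((z + s *\<^sub>R v) + h *\<^sub>R w) - ?k (z + s *\<^sub>R v) =
     frechet_derivative ?k (at ((z + s *\<^sub>R v) + t *\<^sub>R w)) (h *\<^sub>R w)"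
    by auto
  have "g h - g 0 = h * (?k ((z + s *\<^sub>R v) + h *\<^sub>R w) - ?k (z + s *\<^sub>R v))"
    unfolding gs using s lin[OF f[OF in2[of s]], of h v] lin[OF f[OF S0[of s]], of h v]
    by (simp add: algebra_simps)
  also have "\<dots> = h * (h * frechet_derivative ?k (at (z + s *\<^sub>R v + t *\<^sub>R w)) w)"
    unfolding kt using s t lin[OF f'[OF S[of s t]], of h w] by simp
  finally have "g h - g 0 = h * (h * frechet_derivative ?k (at (z + s *\<^sub>R v + t *\<^sub>R w)) w)" .
  moreover have "g h - g 0 = f (z + h *\<^sub>R v + h *\<^sub>R w) - f (z + h *\<^sub>R v) - f (z + h *\<^sub>R w) + f z"
    by (simp add: g_def algebra_simps)
  ultimately show ?thesis using that[of s t] s t by auto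
qed

text \<open>The second difference is symmetric in \<open>v\<close> and \<open>w\<close>, so over
  shrinking parallelograms it expresses both mixed derivatives, each at its own point near
  \<open>z\<close>. These points converge to \<open>z\<close>, and continuity of the second
  derivatives gives equality there.\<close>

lemma second_derivative_symmetric_real:
  fixes f :: "'a::euclidean_space \<Rightarrow> real"
  assumes S: "open S" "z \<in> S" and f: "smooth_on S f"
  shows "frechet_derivative (\<lambda>x. frechet_derivative f (at x) v) (at z) w =
    frechet_derivative (\<lambda>x. frechet_derivative f (at x) w) (at z) v"
proof -
  let ?D = "\<lambda>v w x. frechet_derivative (\<lambda>x. frechet_derivative f (at x) v) (at x) w"
  obtain e where e: "e > 0" "ball z e \<subseteq> S" using S open_contains_ball by blast
  \<comment> \<open>The summand 1 keeps the denominator positive when \<open>v\<close> and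
    \<open>w\<close> vanish and puts the parallelograms strictly inside
    \<open>ball z e\<close>.\<close>
  define r where "r = e / (norm v + norm w + 1)"
  have n: "norm v + norm w + 1 > 0" by (simp add: add_nonneg_pos)
  then have r: "r > 0" using e by (simp add: r_def)
  define h where "h n = r / real (Suc n)" for n
  have h: "h n > 0" "h n \<le> r" for n
    using r by (auto simp: h_def field_simps)
  have near: "dist z (z + s *\<^sub>R v + t *\<^sub>R w) \<le> h n * (norm v + norm w)"
    if "0 \<le> s" "s \<le> h n" "0 \<le> t" "t \<le> h n" for s t n
  proof -
    have "dist z (z + s *\<^sub>R v + t *\<^sub>R w) = norm (s *\<^sub>R v + t *\<^sub>R w)"
      by (metis add.assoc add_diff_cancel_left' dist_commute dist_norm)
    also have "\<dots> \<le> s * norm v + t * norm w"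
      using norm_triangle_ineq[of "s *\<^sub>R v" "t *\<^sub>R w"] that by simp
    also have "\<dots> \<le> h n * norm v + h n * norm w"
      using that by (intro add_mono mult_right_mono) auto
    finally show ?thesis by (simp add: algebra_simps)
  qed
  have inS: "z + s *\<^sub>R v + t *\<^sub>R w \<in> S"
    if "0 \<le> s" "s \<le> h n" "0 \<le> t" "t \<le> h n" for s t n
  proof -
    have "h n * (norm v + norm w) \<le> r * (norm v + norm w)"
      using h by (intro mult_right_mono) auto
    also have "\<dots> < r * (norm v + norm w + 1)"
      using r by simp
    also have "\<dots> = e" using n by (simp add: r_def)
    finally show ?thesis using near[OF that] e by (auto simp: subset_iff)
  qed
  have d: "f differentiable (at x)" "(\<lambda>x. frechet_derivative f (at x) v) differentiable (at x)" if "x \<in> S" for x v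
    using that f by (auto intro: smooth_on_differentiable smooth_on_frechet_derivative)
  have "\<exists>p q. dist z p \<le> h n * (norm v + norm w) \<and> dist z q \<le> h n * (norm v + norm w) \<and> ?D v w p = ?D w v q" for n
  proof -
    obtain s t where 1: "0 \<le> s" "s \<le> h n" "0 \<le> t" "t \<le> h n"
      "f (z + h n *\<^sub>R v + h n *\<^sub>R w) - f (z + h n *\<^sub>R v) - f (z + h n *\<^sub>R w) + f z =
       h n * (h n * ?D v w (z + s *\<^sub>R v + t *\<^sub>R w))"
      using second_difference_mean_value[OF h(1)[of n], of z v w S f] inS d by blast
    have inS': "z + s *\<^sub>R w + t *\<^sub>R v \<in> S" if "0 \<le> s" "s \<le> h n" "0 \<le> t" "t \<le> h n" for s t
      using inS[of t n s] that by (simp add: algebra_simps)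
    obtain s' t' where 2: "0 \<le> s'" "s' \<le> h n" "0 \<le> t'" "t' \<le> h n"
      "f (z + h n *\<^sub>R w + h n *\<^sub>R v) - f (z + h n *\<^sub>R w) - f (z + h n *\<^sub>R v) + f z =
       h n * (h n * ?D w v (z + s' *\<^sub>R w + t' *\<^sub>R v))"
      using second_difference_mean_value[OF h(1)[of n], of z w v S f] inS' d by blast
    have "h n * (h n * ?D v w (z + s *\<^sub>R v + t *\<^sub>R w)) = h n * (h n * ?D w v (z + s' *\<^sub>R w + t' *\<^sub>R v))"
      using 1(5) 2(5) by (simp add: algebra_simps)
    then have "?D v w (z + s *\<^sub>R v + t *\<^sub>R w) = ?D w v (z + s' *\<^sub>R w + t' *\<^sub>R v)"
      using h(1)[of n] by simp
    moreover have "dist z (z + s' *\<^sub>R w + t' *\<^sub>R v) \<le> h n * (norm v + norm w)"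
      using near[of t' n s'] 2 by (simp add: algebra_simps)
    ultimately show ?thesis using near[of s n t] 1 by blast
  qed
  then obtain p q where pq: "\<And>n. dist z (p n) \<le> h n * (norm v + norm w)"
      "\<And>n. dist z (q n) \<le> h n * (norm v + norm w)" "\<And>n. ?D v w (p n) = ?D w v (q n)"
    by metis
  have "(\<lambda>n. r * (norm v + norm w) * (1 / real (Suc n))) \<longlonglongrightarrow> r * (norm v + norm w) * 0"
    by (intro tendsto_intros LIMSEQ_inverse_real_of_nat[unfolded inverse_eq_divide])
  then have h0: "(\<lambda>n. h n * (norm v + norm w)) \<longlonglongrightarrow> 0" by (simp add: h_def mult_ac)
  have lim: "x \<longlonglongrightarrow> z" if "\<And>n. dist z (x n) \<le> h n * (norm v + norm w)" for x
    by (rule tendsto_dist_iff[THEN iffD2, OF tendsto_sandwich[OF _ _ tendsto_const h0]]) (use that in \<open>auto simp: dist_commute\<close>)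
  have c: "isCont (?D v w) z" for v w
    using smooth_on_imp_continuous_on[OF smooth_on_frechet_derivative[OF smooth_on_frechet_derivative[OF f]]]
      S continuous_on_eq_continuous_at by blast
  have "(\<lambda>n. ?D v w (p n)) \<longlonglongrightarrow> ?D v w z"
    using isCont_tendsto_compose[OF c lim[OF pq(1)]] .
  moreover have "(\<lambda>n. ?D w v (q n)) \<longlonglongrightarrow> ?D w v z"
    using isCont_tendsto_compose[OF c lim[OF pq(2)]] .
  ultimately show ?thesis using pq(3) LIMSEQ_unique by simp
qed

text \<open>Inner products with basis vectors commute with derivatives, which reduces the claim to
  real-valued functions. Complex-valued coefficients are the case of interest.\<close>

lemma second_derivative_symmetric:
  fixes f :: "'a::euclidean_space \<Rightarrow> 'b::euclidean_space"
  assumes S: "open S" "z \<in> S" and f: "smooth_on S f"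
  shows "frechet_derivative (\<lambda>x. frechet_derivative f (at x) v) (at z) w =
    frechet_derivative (\<lambda>x. frechet_derivative f (at x) w) (at z) v"
proof (rule euclidean_eqI)
  fix b :: 'b assume "b \<in> Basis"
  have fd: "frechet_derivative (\<lambda>x. g x \<bullet> b) (at x) u = frechet_derivative g (at x) u \<bullet> b"
    if "smooth_on S g" "x \<in> S" for g :: "'a \<Rightarrow> 'b" and x u
    using frechet_derivative_at[OF has_derivative_inner_left[of g "frechet_derivative g (at x)" "at x" b]]
      smooth_on_differentiable[OF that] frechet_derivative_works by metis
  have sb: "smooth_on S (\<lambda>x. f x \<bullet> b)"
    by (rule smooth_on_bounded_linear[OF S(1) bounded_linear_inner_left f])
  have "frechet_derivative (\<lambda>x. frechet_derivative f (at x) v) (at z) w \<bullet> b =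
    frechet_derivative (\<lambda>x. frechet_derivative (\<lambda>x. f x \<bullet> b) (at x) v) (at z) w" for v w
  proof -
    have s: "smooth_on S (\<lambda>x. frechet_derivative f (at x) v)"
      by (rule smooth_on_frechet_derivative[OF f])
    have "frechet_derivative (\<lambda>x. frechet_derivative (\<lambda>x. f x \<bullet> b) (at x) v) (at z) =
      frechet_derivative (\<lambda>x. frechet_derivative f (at x) v \<bullet> b) (at z)"
      by (rule frechet_derivative_transform_within_open[OF _ S])
        (use fd[OF f] smooth_on_differentiable[OF smooth_on_frechet_derivative[OF sb] S(2)] in auto)
    then show ?thesis using fd[OF s S(2)] by simp
  qed
  then show "frechet_derivative (\<lambda>x. frechet_derivative f (at x) v) (at z) w \<bullet> b =
    frechet_derivative (\<lambda>x. frechet_derivative f (at x) w) (at z) v \<bullet> b"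
    using second_derivative_symmetric_real[OF S sb] by simp
qed


section \<open>The wedge product at a point\<close>

text \<open>The grading involution. Forms may be inhomogeneous, so a sign depending on the degree is
  applied as an operator instead of a scalar.\<close>

definition sgn_form :: "'n::finite aform \<Rightarrow> 'n aform" where
  "sgn_form w = (\<lambda>vs. (-1) ^ length vs * w vs)"

text \<open>Interior product with a real tangent vector; \<open>int_dz\<close> is a complex
  combination of two of these.\<close>

definition insert_vec :: "complex^'n::finite \<Rightarrow> 'n aform \<Rightarrow> 'n aform" where
  "insert_vec x w = (\<lambda>vs. w (x # vs))"

lemma insert_vec_apply: "insert_vec x w vs = w (x # vs)"
  by (simp add: insert_vec_def)

text \<open>No position is smaller than 0, so handing the first argument to the first factor creates
  no inversion; the other positions only shift by one.\<close>

lemma card_inversions_insert_0: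
  "card {(i, j). i \<in> insert 0 (Suc ` J) \<and> j \<in> {..<Suc n} - insert 0 (Suc ` J) \<and> j < i} =
   card {(i, j). i \<in> J \<and> j \<in> {..<n} - J \<and> j < i}"
proof -
  have "{(i, j). i \<in> insert 0 (Suc ` J) \<and> j \<in> {..<Suc n} - insert 0 (Suc ` J) \<and> j < i} =
    map_prod Suc Suc ` {(i, j). i \<in> J \<and> j \<in> {..<n} - J \<and> j < i}" (is "?A = ?f ` ?B")
  proof
    show "?A \<subseteq> ?f ` ?B"
    proof
      fix p assume "p \<in> ?A"
      then obtain i j where p: "p = (i, j)"
        and *: "i \<in> insert 0 (Suc ` J)" "j \<in> {..<Suc n}" "j \<notin> insert 0 (Suc ` J)" "j < i" by blast
      then obtain i' j' where "i = Suc i'" "j = Suc j'"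
        by (metis insertI1 less_nat_zero_code not0_implies_Suc)
      then show "p \<in> ?f ` ?B" using p * by (auto simp: image_iff)
    qed
  qed auto
  moreover have "inj_on (map_prod Suc Suc) ?B" by (auto simp: inj_on_def)
  ultimately show ?thesis by (simp add: card_image)
qed

text \<open>Here the first argument goes to the second factor and forms an inversion with each of
  the \<open>card J\<close> positions of the first factor. This extra count is the sign that
  \<open>sgn_form\<close> carries in the recursion.\<close>

lemma card_inversions_Suc_image:
  assumes "J \<subseteq> {..<n}"
  shows "card {(i, j). i \<in> Suc ` J \<and> j \<in> {..<Suc n} - Suc ` J \<and> j < i} =
    card J + card {(i, j). i \<in> J \<and> j \<in> {..<n} - J \<and> j < i}"
proof -
  let ?B = "{(i, j). i \<in> J \<and> j \<in> {..<n} - J \<and> j < i}"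
  have fJ: "finite J" using assms finite_subset by blast
  have "?B \<subseteq> J \<times> {..<n}" by auto
  then have fB: "finite ?B" using fJ by (meson finite_SigmaI finite_lessThan finite_subset)
  have "{(i, j). i \<in> Suc ` J \<and> j \<in> {..<Suc n} - Suc ` J \<and> j < i} =
    (\<lambda>i. (Suc i, 0)) ` J \<union> map_prod Suc Suc ` ?B" (is "?A = ?C \<union> ?D")
  proof
    show "?A \<subseteq> ?C \<union> ?D"
    proof
      fix p assume "p \<in> ?A"
      then obtain i j where "p = (Suc i, j)" "i \<in> J" "j \<in> {..<Suc n}" "j \<notin> Suc ` J" "j < Suc i" by blast
      then show "p \<in> ?C \<union> ?D" by (cases j) (auto simp: image_iff)
    qed
  qed auto
  moreover have "card (?C \<union> ?D) = card ?C + card ?D"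
    using fJ fB by (intro card_Un_disjoint) auto
  moreover have "card ?C = card J" by (intro card_image) (auto simp: inj_on_def)
  moreover have "card ?D = card ?B" by (intro card_image) (auto simp: inj_on_def)
  ultimately show ?thesis by simp
qed

lemma wedge_Nil [simp]: "wedge u v [] = u [] * v []"
  by (simp add: wedge_def)

text \<open>All laws of the wedge product used below follow from this recursion by induction, for arbitrary
  functions on lists: alternation plays no role.\<close>

lemma wedge_Cons:
  "wedge u v (x # vs) = wedge (insert_vec x u) v vs + wedge (sgn_form u) (insert_vec x v) vs"
proof -
  define n where "n = length vs"
  define F where "F I = (-1) ^ card {(i, j). i \<in> I \<and> j \<in> {..<Suc n} - I \<and> j < i}
    * u (nths (x # vs) I) * v (nths (x # vs) (- I))" for I
  \<comment> \<open>The shuffles are split according to which factor receives position 0.\<close>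
  have P: "Pow {..<Suc n} = (`) Suc ` Pow {..<n} \<union> (insert 0 \<circ> (`) Suc) ` Pow {..<n}"
    by (simp only: lessThan_Suc_eq_insert_0 Pow_insert image_comp image_Pow_surj[OF refl, symmetric])
  have "wedge u v (x # vs) = (\<Sum>I\<in>Pow {..<Suc n}. F I)"
    by (simp add: wedge_def F_def n_def)
  also have "\<dots> = (\<Sum>I\<in>(insert 0 \<circ> (`) Suc) ` Pow {..<n}. F I) + (\<Sum>I\<in>(`) Suc ` Pow {..<n}. F I)"
    unfolding P by (subst sum.union_disjoint) (auto simp: add.commute)
  also have "(\<Sum>I\<in>(insert 0 \<circ> (`) Suc) ` Pow {..<n}. F I) = (\<Sum>J\<in>Pow {..<n}. F (insert 0 (Suc ` J)))"
  proof (subst sum.reindex)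
    show "inj_on (insert 0 \<circ> (`) Suc) (Pow {..<n})"
    proof (rule inj_onI)
      have pre: "{j. Suc j \<in> insert 0 (Suc ` J)} = J" for J by auto
      fix J K assume "(insert 0 \<circ> (`) Suc) J = (insert 0 \<circ> (`) Suc) K"
      then show "J = K" using pre[of J] pre[of K] by simp
    qed
  qed simp
  also have "\<dots> = wedge (insert_vec x u) v vs"
    unfolding wedge_def
  proof (intro sum.cong)
    fix J
    have "{j. Suc j \<in> insert 0 (Suc ` J)} = J" "{j. Suc j \<in> - insert 0 (Suc ` J)} = - J" by auto
    then show "F (insert 0 (Suc ` J)) = (-1) ^ card {(i, j). i \<in> J \<and> j \<in> {..<length vs} - J \<and> j < i} *
        insert_vec x u (nths vs J) * v (nths vs (- J))"
      unfolding F_def card_inversions_insert_0 by (simp add: nths_Cons insert_vec_def n_def)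
  qed (simp add: n_def)
  also have "(\<Sum>I\<in>(`) Suc ` Pow {..<n}. F I) = (\<Sum>J\<in>Pow {..<n}. F (Suc ` J))"
    by (subst sum.reindex) (auto simp: inj_on_def)
  also have "\<dots> = wedge (sgn_form u) (insert_vec x v) vs"
    unfolding wedge_def
  proof (intro sum.cong)
    fix J assume "J \<in> Pow {..<length vs}"
    then have J: "J \<subseteq> {..<n}" by (simp add: n_def)
    then have "{i. i < length vs \<and> i \<in> J} = J" by (auto simp: n_def)
    then have "length (nths vs J) = card J" by (simp add: length_nths)
    moreover have "{j. Suc j \<in> Suc ` J} = J" "{j. Suc j \<in> - Suc ` J} = - J" by auto
    ultimately show "F (Suc ` J) = (-1) ^ card {(i, j). i \<in> J \<and> j \<in> {..<length vs} - J \<and> j < i} *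
        sgn_form u (nths vs J) * insert_vec x v (nths vs (- J))"
      unfolding F_def card_inversions_Suc_image[OF J]
      by (simp add: nths_Cons insert_vec_def sgn_form_def n_def power_add mult_ac)
  qed (simp add: n_def)
  finally show ?thesis .
qed

section \<open>Algebraic laws of the wedge product\<close>

lemma wedge_add_left: "wedge (u + v) w = wedge u w + wedge v w"
  by (rule ext) (simp add: wedge_def algebra_simps sum.distrib)

lemma wedge_add_right: "wedge u (v + w) = wedge u v + wedge u w"
  by (rule ext) (simp add: wedge_def algebra_simps sum.distrib)

lemma wedge_scale_left: "wedge (\<lambda>vs. a * u vs) w = (\<lambda>vs. a * wedge u w vs)"
  by (rule ext) (simp add: wedge_def sum_distrib_left mult_ac)

lemma wedge_scale_right: "wedge u (\<lambda>vs. a * w vs) = (\<lambda>vs. a * wedge u w vs)"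
  by (rule ext) (simp add: wedge_def sum_distrib_left mult_ac)

lemma wedge_zero [simp]: "wedge 0 w = 0" "wedge u 0 = 0"
  by (auto simp: wedge_def)

lemma wedge_minus: "wedge (- u) w = - wedge u w" "wedge u (- w) = - wedge u w"
  using wedge_scale_left[of "-1" u w] wedge_scale_right[of u "-1" w] by (auto simp: fun_Compl_def)

lemma insert_vec_simps:
  "insert_vec x (u + v) = insert_vec x u + insert_vec x v"
  "insert_vec x (wedge u v) = wedge (insert_vec x u) v + wedge (sgn_form u) (insert_vec x v)"
  "insert_vec x (sgn_form u) = - sgn_form (insert_vec x u)"
  by (auto simp: insert_vec_def wedge_Cons sgn_form_def)

lemma sgn_form_simps:
  "sgn_form (u + v) = sgn_form u + sgn_form v"
  "sgn_form (- u) = - sgn_form u"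
  "sgn_form (sgn_form u) = u"
  by (auto simp: sgn_form_def algebra_simps simp flip: power_add)

lemma sgn_form_wedge: "sgn_form (wedge u v) = wedge (sgn_form u) (sgn_form v)"
proof
  show "sgn_form (wedge u v) vs = wedge (sgn_form u) (sgn_form v) vs" for vs
  proof (induction vs arbitrary: u v)
    case Nil
    show ?case by (simp add: sgn_form_def)
  next
    case (Cons x vs)
    have "sgn_form (wedge u v) (x # vs) =
      - (sgn_form (wedge (insert_vec x u) v) vs + sgn_form (wedge (sgn_form u) (insert_vec x v)) vs)"
      by (simp add: sgn_form_def[of "wedge _ _"] wedge_Cons algebra_simps)
    then show ?case
      by (simp add: Cons.IH wedge_Cons insert_vec_simps wedge_minus)
  qed
qed

text \<open>Each \<open>insert_vec x\<close> is an antiderivation and \<open>sgn_form\<close> is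
  multiplicative, so both bracketings obey the same recursion. It alters the factors, hence the
  induction over arbitrary \<open>u\<close>, \<open>v\<close>, \<open>w\<close>.\<close>

lemma wedge_assoc: "wedge (wedge u v) w = wedge u (wedge v w)"
proof
  show "wedge (wedge u v) w vs = wedge u (wedge v w) vs" for vs
    by (induction vs arbitrary: u v w)
      (simp_all add: wedge_Cons insert_vec_simps wedge_add_left wedge_add_right sgn_form_wedge)
qed

definition degree_one :: "'n::finite aform \<Rightarrow> bool" where
  "degree_one w \<longleftrightarrow> (\<forall>vs. length vs \<noteq> 1 \<longrightarrow> w vs = 0)"

lemma wedge_scalar:
  assumes "\<And>vs. vs \<noteq> [] \<Longrightarrow> c vs = 0"
  shows "wedge c w = (\<lambda>vs. c [] * w vs)" "wedge w c = (\<lambda>vs. c [] * w vs)"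
proof -
  have ic: "insert_vec x c = 0" for x using assms by (auto simp: insert_vec_def)
  have sc: "sgn_form c = c" 
  proof
    show "sgn_form c vs = c vs" for vs by (cases "vs = []") (simp_all add: sgn_form_def assms)
  qed
  have "wedge c w vs = c [] * w vs \<and> wedge w c vs = c [] * w vs" for vs
    by (induction vs arbitrary: w) (simp_all add: wedge_Cons ic sc insert_vec_apply)
  then show "wedge c w = (\<lambda>vs. c [] * w vs)" "wedge w c = (\<lambda>vs. c [] * w vs)" by auto
qed

lemma wedge_one_form0 [simp]: "wedge one_form0 w = w" "wedge w one_form0 = w"
  using wedge_scalar[of one_form0 w] by (simp_all add: one_form0_def)

lemma degree_one_sgn:
  assumes "degree_one a"
  shows "sgn_form a = - a"
proof
  show "sgn_form a vs = (- a) vs" for vs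
    using assms by (cases "length vs = 1") (auto simp: degree_one_def sgn_form_def)
qed

text \<open>A vector inserted into \<open>a\<close> leaves a scalar, which commutes with everything;
  a vector inserted into \<open>v\<close> is handled by the induction hypothesis. Writing the sign
  as \<open>sgn_form v\<close> admits inhomogeneous \<open>v\<close>.\<close>

lemma wedge_degree_one_commute:
  assumes "degree_one a"
  shows "wedge a v = wedge (sgn_form v) a"
proof
  have a: "insert_vec x a vs = 0" if "vs \<noteq> []" for x vs
    using assms that by (auto simp: degree_one_def insert_vec_def)
  show "wedge a v vs = wedge (sgn_form v) a vs" for vs
  proof (induction vs arbitrary: v)
    case Nil
    show ?case using assms by (simp add: degree_one_def)
  next
    case (Cons x vs)
    have "wedge a (insert_vec x v) vs = wedge (sgn_form (insert_vec x v)) a vs" by (rule Cons.IH)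
    then show ?case
      using wedge_scalar[of "insert_vec x a" v] wedge_scalar[of "insert_vec x a" "v"] a
      by (simp add: wedge_Cons degree_one_sgn[OF assms] wedge_minus insert_vec_simps sgn_form_simps)
  qed
qed

section \<open>Interior products with the holomorphic frame\<close>

lemma int_dz_insert_vec:
  "int_dz k w = (\<lambda>vs. (insert_vec (axis k 1) w vs - \<i> * insert_vec (axis k \<i>) w vs) / 2)"
  by (simp add: int_dz_def insert_vec_def)

lemma int_dz_wedge: "int_dz k (wedge u v) = wedge (int_dz k u) v + wedge (sgn_form u) (int_dz k v)"
proof -
  have *: "int_dz k w = (\<lambda>vs. 1/2 * insert_vec (axis k 1) w vs) + (\<lambda>vs. - \<i> / 2 * insert_vec (axis k \<i>) w vs)" for w
    by (rule ext) (simp add: int_dz_insert_vec diff_divide_distrib)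
  show ?thesis
    unfolding * insert_vec_simps wedge_add_left wedge_add_right wedge_scale_left wedge_scale_right
    by (auto simp: algebra_simps)
qed

lemma int_dz_dz: "int_dz k (dz j) = (if k = j then one_form0 else 0)"
  by (auto simp: int_dz_def one_form0_def dz_def axis_def fun_eq_iff split: list.split)

text \<open>The two insertions cancel because \<open>1 - \<i> * cnj \<i> = 0\<close>.\<close>

lemma int_dz_dzbar: "int_dz k (dzbar j) = 0"
  by (auto simp: int_dz_def dzbar_def axis_def fun_eq_iff split: list.split)

lemma degree_one_dz: "degree_one (dz j)"
  by (auto simp: degree_one_def dz_def split: list.split)

lemma degree_one_dzbar: "degree_one (dzbar j)"
  by (auto simp: degree_one_def dzbar_def split: list.split)

lemma pq_type_0_1E:
  assumes "pq_type 0 1 w"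
  obtains a where "w = (\<lambda>vs. \<Sum>j\<in>UNIV. a j * dzbar j vs)"
proof -
  from assms obtain a where w: "w = (\<lambda>vs. \<Sum>I | length I = 0. \<Sum>J | length J = 1.
       a I J * foldr wedge (map dz I @ map dzbar J) one_form0 vs)"
    unfolding pq_type_def by blast
  have 1: "{J :: 'a list. length J = 1} = (\<lambda>j. [j]) ` UNIV"
    by (auto simp: length_Suc_conv)
  have "w vs = (\<Sum>j\<in>UNIV. a [] [j] * dzbar j vs)" for vs
    unfolding w 1 by (subst sum.reindex) (auto simp: inj_on_def)
  then show ?thesis using that[of "\<lambda>j. a [] [j]"] by blast
qed

lemma pq_type_0_1_degree_one: "pq_type 0 1 w \<Longrightarrow> degree_one w"
  by (erule pq_type_0_1E) (auto simp: degree_one_def dzbar_def split: list.split intro!: sum.neutral)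

lemma pq_type_0_1_int_dz: 
  assumes "pq_type 0 1 w" shows "int_dz k w = 0"
proof -
  obtain a where w: "w = (\<lambda>vs. \<Sum>j\<in>UNIV. a j * dzbar j vs)" using pq_type_0_1E[OF assms] .
  have "int_dz k w vs = (\<Sum>j\<in>UNIV. a j * int_dz k (dzbar j) vs)" for vs
    unfolding int_dz_def w sum_distrib_left sum_subtractf[symmetric] sum_divide_distrib
    by (rule sum.cong) (simp_all add: algebra_simps)
  then show ?thesis by (auto simp: int_dz_dzbar)
qed

text \<open>Polarisation: expanding \<open>w\<close> on a repeated argument \<open>x + y\<close>
  gives antisymmetry in the first two slots, which are the slots that the two interior products
  fill.\<close>

lemma alternating_int_dz_anticommute:
  assumes "alternating w"
  shows "int_dz j (int_dz k w) = - int_dz k (int_dz j w)"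
proof -
  have swap: "w (x # y # vs) = - w (y # x # vs)" for x y vs
  proof -
    have lin: "linear (\<lambda>v. w (xs @ v # ys))" for xs ys using assms by (simp add: alternating_def)
    have a: "w (x # (y + z) # vs) = w (x # y # vs) + w (x # z # vs)"
      "w ((y + z) # x # vs) = w (y # x # vs) + w (z # x # vs)" for x y z
      using linear_add[OF lin[of "[x]" vs]] linear_add[OF lin[of "[]" "x # vs"]] by simp_all
    have z: "w (x # x # vs) = 0" for x using assms by (simp add: alternating_def)
    have "0 = w ((x + y) # (x + y) # vs)" by (simp add: z)
    also have "\<dots> = w (x # y # vs) + w (y # x # vs)" unfolding a by (simp add: z)
    finally show ?thesis by (simp add: eq_neg_iff_add_eq_0)
  qed
  show ?thesis
    by (rule ext) (simp add: int_dz_def swap[of "axis k _" "axis j _"] field_simps)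
qed


section \<open>Wirtinger derivatives\<close>

lemma sum_fun_apply: "(\<Sum>i\<in>I. f i) x = (\<Sum>i\<in>I. f i x)"
  by (induction I rule: infinite_finite_induct) auto

text \<open>Common form of \<open>wirt\<close> (\<open>\<alpha> = - \<i>\<close>) and \<open>wirtbar\<close> (\<open>\<alpha> = \<i>\<close>).\<close>

definition wirt_gen :: "complex \<Rightarrow> 'n::finite \<Rightarrow> (complex^'n \<Rightarrow> complex) \<Rightarrow> complex^'n \<Rightarrow> complex" where
  "wirt_gen \<alpha> j f z =
     (frechet_derivative f (at z) (axis j 1) + \<alpha> * frechet_derivative f (at z) (axis j \<i>)) / 2"

lemma wirt_gen_eq:
  "(f has_derivative D) (at z) \<Longrightarrow> wirt_gen \<alpha> j f z = (D (axis j 1) + \<alpha> * D (axis j \<i>)) / 2"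
  by (simp add: wirt_gen_def flip: frechet_derivative_at)

lemma wirt_gen_const [simp]: "wirt_gen \<alpha> j (\<lambda>z. a) z = 0"
  by (simp add: wirt_gen_def)

lemma wirt_gen_add:
  assumes "f differentiable (at z)" "g differentiable (at z)"
  shows "wirt_gen \<alpha> j (\<lambda>z. f z + g z) z = wirt_gen \<alpha> j f z + wirt_gen \<alpha> j g z"
  using has_derivative_add[OF assms[unfolded frechet_derivative_works]]
  by (subst wirt_gen_eq) (auto simp: wirt_gen_def field_simps)

lemma wirt_gen_mult:
  assumes "f differentiable (at z)" "g differentiable (at z)"
  shows "wirt_gen \<alpha> j (\<lambda>z. f z * g z) z = wirt_gen \<alpha> j f z * g z + f z * wirt_gen \<alpha> j g z"
  using has_derivative_mult[OF assms[unfolded frechet_derivative_works]]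
  by (subst wirt_gen_eq) (auto simp: wirt_gen_def field_simps)

lemma wirt_gen_cmult:
  "f differentiable (at z) \<Longrightarrow> wirt_gen \<alpha> j (\<lambda>z. a * f z) z = a * wirt_gen \<alpha> j f z"
  by (subst wirt_gen_mult) auto

lemma wirt_gen_sum:
  "(\<And>i. i \<in> I \<Longrightarrow> f i differentiable (at z)) \<Longrightarrow>
   wirt_gen \<alpha> j (\<lambda>z. \<Sum>i\<in>I. f i z) z = (\<Sum>i\<in>I. wirt_gen \<alpha> j (f i) z)"
proof (induction I rule: infinite_finite_induct)
  case (insert i I)
  have "(\<lambda>z. \<Sum>i\<in>I. f i z) differentiable (at z)"
    using insert by (intro differentiable_sum) auto
  then show ?case using insert by (simp add: wirt_gen_add)
qed auto

lemma smooth_on_wirt_gen: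
  assumes "open S" "smooth_on S f"
  shows "smooth_on S (wirt_gen \<alpha> j f)"
proof -
  have "smooth_on S (\<lambda>z. 1/2 * (frechet_derivative f (at z) (axis j 1) +
      \<alpha> * frechet_derivative f (at z) (axis j \<i>)))"
    using assms by (intro smooth_on_mult smooth_on_add smooth_on_const smooth_on_frechet_derivative)
  then show ?thesis by (rule smooth_on_cong[OF assms(1), rotated]) (simp add: wirt_gen_def)
qed

lemma wirt_gen_cong:
  assumes "open S" "z \<in> S" "f differentiable (at z)" "\<And>x. x \<in> S \<Longrightarrow> f x = g x"
  shows "wirt_gen \<alpha> j f z = wirt_gen \<alpha> j g z"
  unfolding wirt_gen_def using frechet_derivative_transform_within_open[OF assms(3,1,2,4)] by simp

text \<open>Both sides expand into second derivatives along frame directions, which are symmetric.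
  Free \<open>\<alpha>\<close> and \<open>\<beta>\<close> cover all pairs of holomorphic and
  antiholomorphic derivatives.\<close>

lemma wirt_gen_commute:
  assumes "open S" "z \<in> S" "smooth_on S f"
  shows "wirt_gen \<alpha> j (wirt_gen \<beta> k f) z = wirt_gen \<beta> k (wirt_gen \<alpha> j f) z"
proof -
  let ?d = "\<lambda>v x. frechet_derivative f (at x) v" and ?dd = "\<lambda>v w. frechet_derivative (\<lambda>x. frechet_derivative f (at x) v) (at z) w"
  have d: "?d v differentiable (at z)" for v
    using smooth_on_differentiable[OF smooth_on_frechet_derivative[OF assms(3)] assms(2)] .
  have eq: "wirt_gen \<alpha> j (wirt_gen \<beta> k f) z =
    ((?dd (axis k 1) (axis j 1) + \<alpha> * ?dd (axis k 1) (axis j \<i>)) / 2 +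
      \<beta> * ((?dd (axis k \<i>) (axis j 1) + \<alpha> * ?dd (axis k \<i>) (axis j \<i>)) / 2)) / 2" for \<alpha> \<beta> j k
  proof -
    have "wirt_gen \<beta> k f = (\<lambda>z. 1/2 * (?d (axis k 1) z + \<beta> * ?d (axis k \<i>) z))"
      by (rule ext) (simp add: wirt_gen_def)
    then have "wirt_gen \<alpha> j (wirt_gen \<beta> k f) z =
        1/2 * (wirt_gen \<alpha> j (?d (axis k 1)) z + \<beta> * wirt_gen \<alpha> j (?d (axis k \<i>)) z)"
      by (simp only: wirt_gen_cmult wirt_gen_add d differentiable_mult differentiable_add differentiable_const)
    then show ?thesis by (simp add: wirt_gen_def)
  qed
  have "?dd v w = ?dd w v" for v w
    by (rule second_derivative_symmetric[OF assms])
  \<comment> \<open>Fixing the \<open>k\<close>-direction first and the \<open>j\<close>-direction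
    second orients the symmetry, so that rewriting with it terminates.\<close>
  note s = this[of "axis k _" "axis j _"]
  show ?thesis unfolding eq by (simp add: s field_simps)
qed


section \<open>Operators on forms over an atlas\<close>

text \<open>The same expression in every chart. It need not respect transition maps, but the
  operators act chart by chart, and it makes the coframe covectors available as arguments of
  \<open>gwedge\<close>.\<close>

definition const_form :: "'n::finite aform \<Rightarrow> ('a, 'n) gform" where
  "const_form w = (\<lambda>c z. w)"

definition gsgn :: "('a, 'n::finite) gform \<Rightarrow> ('a, 'n) gform" where
  "gsgn u = (\<lambda>c z. sgn_form (u c z))"

definition gint :: "'n::finite \<Rightarrow> ('a, 'n) gform \<Rightarrow> ('a, 'n) gform" where
  "gint k u = (\<lambda>c z. int_dz k (u c z))"

definition gdegree_one :: "('a, 'n::finite) gform \<Rightarrow> bool" where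
  "gdegree_one u \<longleftrightarrow> (\<forall>c z. degree_one (u c z))"

definition gpd :: "('a, 'n::finite) chart set \<Rightarrow> complex \<Rightarrow> 'n \<Rightarrow> ('a, 'n) gform \<Rightarrow> ('a, 'n) gform" where
  "gpd A \<alpha> j u = (\<lambda>c z vs. if c \<in> A \<and> z \<in> cimage c then wirt_gen \<alpha> j (\<lambda>w. u c w vs) z else 0)"

text \<open>The regularity part of membership in \<open>forms\<close>. It is stable under operations
  such as \<open>gint k\<close>, whose results depend on the coordinates and need not be global
  forms.\<close>

definition gsmooth :: "('a, 'n::finite) chart set \<Rightarrow> ('a, 'n) gform \<Rightarrow> bool" where
  "gsmooth A u \<longleftrightarrow> (\<forall>c\<in>A. \<forall>vs. smooth_on (cimage c) (\<lambda>z. u c z vs))"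

text \<open>\<open>dz\<close> with \<open>- \<i>\<close> gives \<open>del\<close>, and
  \<open>dzbar\<close> with \<open>\<i>\<close> gives \<open>delbar\<close>, so both share one
  Leibniz rule and one anticommutation argument.\<close>

definition ext_deriv :: "('a, 'n::finite) chart set \<Rightarrow> ('n \<Rightarrow> 'n aform) \<Rightarrow> complex \<Rightarrow>
    ('a, 'n) gform \<Rightarrow> ('a, 'n) gform" where
  "ext_deriv A E \<alpha> u = (\<Sum>j\<in>UNIV. gwedge (const_form (E j)) (gpd A \<alpha> j u))"

lemma ddz_eq_gpd: "ddz A j = gpd A (- \<i>) j"
  by (intro ext) (simp add: ddz_def gpd_def wirt_def wirt_gen_def)

lemma ddzbar_eq_gpd: "ddzbar A j = gpd A \<i> j"
  by (intro ext) (simp add: ddzbar_def gpd_def wirtbar_def wirt_gen_def)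

lemma del_eq_ext_deriv: "del A = ext_deriv A dz (- \<i>)"
  by (intro ext) (simp add: del_def ext_deriv_def sum_fun_apply gwedge_def const_form_def ddz_eq_gpd)

lemma delbar_eq_ext_deriv: "delbar A = ext_deriv A dzbar \<i>"
  by (intro ext) (simp add: delbar_def ext_deriv_def sum_fun_apply gwedge_def const_form_def ddzbar_eq_gpd)


section \<open>Pointwise algebra carried over to families of local expressions\<close>

lemma gwedge_add: "gwedge (u + v) w = gwedge u w + gwedge v w" "gwedge u (v + w) = gwedge u v + gwedge u w"
  by (auto simp: gwedge_def fun_eq_iff wedge_add_left wedge_add_right)

lemma gwedge_zero [simp]: "gwedge 0 w = 0" "gwedge u 0 = 0"
  by (auto simp: gwedge_def fun_eq_iff)

lemma gwedge_minus: "gwedge (- u) w = - gwedge u w" "gwedge u (- w) = - gwedge u w"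
  by (auto simp: gwedge_def fun_eq_iff wedge_minus)

lemma gwedge_diff: "gwedge (u - v) w = gwedge u w - gwedge v w" "gwedge u (v - w) = gwedge u v - gwedge u w"
  by (metis (no_types, lifting) diff_conv_add_uminus gwedge_add(1) gwedge_minus(1))
     (metis (no_types, lifting) diff_conv_add_uminus gwedge_add(2) gwedge_minus(2))

lemma gwedge_sum:
  "gwedge (\<Sum>i\<in>I. f i) w = (\<Sum>i\<in>I. gwedge (f i) w)"
  "gwedge u (\<Sum>i\<in>I. f i) = (\<Sum>i\<in>I. gwedge u (f i))"
  by (induction I rule: infinite_finite_induct) (simp_all add: gwedge_add)

lemma gwedge_assoc: "gwedge (gwedge u v) w = gwedge u (gwedge v w)"
  by (simp add: gwedge_def wedge_assoc)

lemma gsgn_simps: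
  "gsgn (gwedge u v) = gwedge (gsgn u) (gsgn v)"
  "gsgn (gsgn u) = u"
  by (auto simp: gsgn_def gwedge_def fun_eq_iff sgn_form_def algebra_simps sgn_form_wedge[unfolded sgn_form_def, THEN fun_cong]
      simp flip: power_add)

lemma gsgn_degree_one: "gdegree_one a \<Longrightarrow> gsgn a = - a"
  by (intro ext) (simp add: gdegree_one_def gsgn_def degree_one_sgn del: split_paired_All)

lemma gwedge_degree_one_commute: "gdegree_one a \<Longrightarrow> gwedge a v = gwedge (gsgn v) a"
  unfolding gdegree_one_def gwedge_def gsgn_def using wedge_degree_one_commute by blast

lemma gwedge_degree_one_anticommute:
  assumes "gdegree_one a" "gdegree_one b"
  shows "gwedge a (gwedge b w) = - gwedge b (gwedge a w)"
  using gwedge_degree_one_commute[OF assms(1), of b] gsgn_degree_one[OF assms(2)]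
  by (metis gwedge_assoc gwedge_minus(1))

lemma gwedge_degree_one_gsgn:
  "gdegree_one a \<Longrightarrow> gwedge a (gwedge (gsgn v) w) = gwedge v (gwedge a w)"
  by (metis gwedge_degree_one_commute gwedge_assoc gsgn_simps(2))

lemma gint_simps:
  "gint k (u + v) = gint k u + gint k v"
  "gint k (- u) = - gint k u"
  "gint k (u - v) = gint k u - gint k v"
  "gint k (gwedge u v) = gwedge (gint k u) v + gwedge (gsgn u) (gint k v)"
  by (auto simp: gint_def gsgn_def fun_eq_iff int_dz_wedge gwedge_def)
     (auto simp: int_dz_def field_simps)

lemma gint_zero [simp]: "gint k 0 = 0"
  by (auto simp: gint_def int_dz_def fun_eq_iff)

lemma gint_sum: "gint k (\<Sum>i\<in>I. f i) = (\<Sum>i\<in>I. gint k (f i))"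
  by (intro ext) (simp add: gint_def int_dz_def sum_fun_apply sum_subtractf sum_distrib_left
      flip: sum_divide_distrib)

lemma gwedge_gint_dz: "gwedge (gint k (const_form (dz j))) v = (if k = j then v else 0)"
  by (auto simp: gwedge_def gint_def const_form_def int_dz_dz fun_eq_iff)

lemma gint_dzbar: "gint k (const_form (dzbar j)) = 0"
  by (auto simp: gint_def const_form_def int_dz_dzbar fun_eq_iff)

lemma gdegree_one_const_form: "degree_one w \<Longrightarrow> gdegree_one (const_form w)"
  by (simp add: gdegree_one_def const_form_def)

section \<open>Derivatives of coefficients\<close>

lemma gpd_zero [simp]: "gpd A \<alpha> j 0 = 0"
  by (auto simp: gpd_def fun_eq_iff)

lemma gpd_const_form [simp]: "gpd A \<alpha> j (const_form w) = 0"
  by (auto simp: gpd_def const_form_def fun_eq_iff)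

lemma gdegree_one_gpd: "gdegree_one u \<Longrightarrow> gdegree_one (gpd A \<alpha> j u)"
  by (auto simp: gdegree_one_def degree_one_def gpd_def)

lemma gsmooth_differentiable:
  "gsmooth A u \<Longrightarrow> c \<in> A \<Longrightarrow> z \<in> cimage c \<Longrightarrow> (\<lambda>z. u c z vs) differentiable (at z)"
  by (auto simp: gsmooth_def intro: smooth_on_differentiable)

lemma gsmooth_const_form [simp]: "gsmooth A (const_form w)"
  by (auto simp: gsmooth_def const_form_def smooth_on_const)

lemma gsmooth_zero [simp]: "gsmooth A 0"
  by (auto simp: gsmooth_def smooth_on_const)

lemma gpd_add:
  "gsmooth A u \<Longrightarrow> gsmooth A v \<Longrightarrow> gpd A \<alpha> j (u + v) = gpd A \<alpha> j u + gpd A \<alpha> j v"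
  by (auto simp: gpd_def fun_eq_iff wirt_gen_add gsmooth_differentiable)

lemma gpd_minus: "gsmooth A u \<Longrightarrow> gpd A \<alpha> j (- u) = - gpd A \<alpha> j u"
  using wirt_gen_cmult[of _ _ \<alpha> j "-1"]
  by (auto simp: gpd_def fun_eq_iff gsmooth_differentiable)

text \<open>The inserted frame vectors are constant in each chart.\<close>

lemma gpd_gint: "gsmooth A u \<Longrightarrow> gpd A \<alpha> j (gint k u) = gint k (gpd A \<alpha> j u)"
proof (intro ext)
  fix c z vs
  assume u: "gsmooth A u"
  have e: "gint k u c w vs = 1/2 * u c w (axis k 1 # vs) + (- \<i>/2) * u c w (axis k \<i> # vs)" for w
    by (simp add: gint_def int_dz_def field_simps)
  show "gpd A \<alpha> j (gint k u) c z vs = gint k (gpd A \<alpha> j u) c z vs"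
  proof (cases "c \<in> A \<and> z \<in> cimage c")
    case True
    then have "wirt_gen \<alpha> j (\<lambda>w. gint k u c w vs) z =
      1/2 * wirt_gen \<alpha> j (\<lambda>w. u c w (axis k 1 # vs)) z + (- \<i>/2) * wirt_gen \<alpha> j (\<lambda>w. u c w (axis k \<i> # vs)) z"
      by (simp only: e wirt_gen_add wirt_gen_cmult gsmooth_differentiable[OF u] differentiable_mult differentiable_const)
    then show ?thesis
      using True by (auto simp: gpd_def gint_def int_dz_def field_simps)
  qed (auto simp: gpd_def gint_def int_dz_def)
qed

text \<open>The wedge product is a finite sum of products of coefficients with constant signs, so a
  derivative of coefficients satisfies the unsigned Leibniz rule.\<close>

lemma gpd_gwedge:
  assumes "gsmooth A u" "gsmooth A v"
  shows "gpd A \<alpha> j (gwedge u v) = gwedge (gpd A \<alpha> j u) v + gwedge u (gpd A \<alpha> j v)"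
proof (intro ext)
  fix c z vs
  note d = gsmooth_differentiable[OF assms(1)] gsmooth_differentiable[OF assms(2)]
  show "gpd A \<alpha> j (gwedge u v) c z vs = (gwedge (gpd A \<alpha> j u) v + gwedge u (gpd A \<alpha> j v)) c z vs"
    by (auto simp: gpd_def gwedge_def wedge_def wirt_gen_sum wirt_gen_mult wirt_gen_cmult d
        algebra_simps sum.distrib)
qed

context
  fixes A :: "('a, 'n::finite) chart set"
  assumes open_cimage: "\<forall>c\<in>A. open (cimage c)"
begin

lemma gsmooth_add: "gsmooth A u \<Longrightarrow> gsmooth A v \<Longrightarrow> gsmooth A (u + v)"
  using open_cimage by (auto simp: gsmooth_def intro: smooth_on_add)

lemma gsmooth_minus:
  assumes "gsmooth A u"
  shows "gsmooth A (- u)"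
proof -
  have "smooth_on (cimage c) (\<lambda>z. (-1) * u c z vs)" if "c \<in> A" for c vs
    using assms that open_cimage by (intro smooth_on_mult smooth_on_const) (auto simp: gsmooth_def)
  then show ?thesis by (simp add: gsmooth_def)
qed

lemma gpd_diff:
  "gsmooth A u \<Longrightarrow> gsmooth A v \<Longrightarrow> gpd A \<alpha> j (u - v) = gpd A \<alpha> j u - gpd A \<alpha> j v"
  using gpd_add[of A u "- v" \<alpha> j] gsmooth_minus[of v] by (simp add: gpd_minus)

lemma gsmooth_diff: "gsmooth A u \<Longrightarrow> gsmooth A v \<Longrightarrow> gsmooth A (u - v)"
  using gsmooth_add[of u "- v"] gsmooth_minus by simp

lemma gsmooth_sum: "(\<And>i. i \<in> I \<Longrightarrow> gsmooth A (f i)) \<Longrightarrow> gsmooth A (\<Sum>i\<in>I. f i)"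
  by (induction I rule: infinite_finite_induct) (auto intro: gsmooth_add)

lemma gsmooth_gwedge: "gsmooth A u \<Longrightarrow> gsmooth A v \<Longrightarrow> gsmooth A (gwedge u v)"
  using open_cimage
  by (auto simp: gsmooth_def gwedge_def wedge_def intro!: smooth_on_sum smooth_on_mult smooth_on_const)

lemma gsmooth_gint:
  assumes "gsmooth A u"
  shows "gsmooth A (gint k u)"
proof -
  have "smooth_on (cimage c) (\<lambda>z. 1/2 * u c z (axis k 1 # vs) + (- \<i>/2) * u c z (axis k \<i> # vs))"
    if "c \<in> A" for c vs
    using assms that open_cimage by (intro smooth_on_mult smooth_on_const smooth_on_add) (auto simp: gsmooth_def)
  then show ?thesis by (simp add: gsmooth_def gint_def int_dz_def field_simps)
qed

lemma gsmooth_gpd: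
  assumes "gsmooth A u"
  shows "gsmooth A (gpd A \<alpha> j u)"
  unfolding gsmooth_def
proof (intro ballI allI)
  fix c vs assume c: "c \<in> A"
  have "smooth_on (cimage c) (wirt_gen \<alpha> j (\<lambda>z. u c z vs))"
    using assms c by (intro smooth_on_wirt_gen bspec[OF open_cimage]) (auto simp: gsmooth_def)
  then show "smooth_on (cimage c) (\<lambda>z. gpd A \<alpha> j u c z vs)"
    by (rule smooth_on_cong[OF bspec[OF open_cimage c], rotated]) (simp add: gpd_def c)
qed

lemma gpd_sum: "(\<And>i. i \<in> I \<Longrightarrow> gsmooth A (f i)) \<Longrightarrow> gpd A \<alpha> j (\<Sum>i\<in>I. f i) = (\<Sum>i\<in>I. gpd A \<alpha> j (f i))"
  by (induction I rule: infinite_finite_induct) (auto simp: gpd_add gsmooth_sum)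

lemma gpd_commute:
  assumes "gsmooth A u"
  shows "gpd A \<alpha> j (gpd A \<beta> k u) = gpd A \<beta> k (gpd A \<alpha> j u)"
proof (intro ext)
  fix c z vs
  have "gpd A \<alpha> j (gpd A \<beta> k u) c z vs = wirt_gen \<alpha> j (wirt_gen \<beta> k (\<lambda>w. u c w vs)) z"
    if "c \<in> A" "z \<in> cimage c" for \<alpha> \<beta> j k
  proof -
    \<comment> \<open>\<open>gpd\<close> agrees with \<open>wirt_gen\<close> only on
      \<open>cimage c\<close>, whose openness permits the replacement under the outer
      derivative.\<close>
    have "wirt_gen \<alpha> j (\<lambda>w. gpd A \<beta> k u c w vs) z = wirt_gen \<alpha> j (wirt_gen \<beta> k (\<lambda>w. u c w vs)) z"
      using that by (intro wirt_gen_cong[OF bspec[OF open_cimage]] gsmooth_differentiable[OF gsmooth_gpd[OF assms]])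
        (auto simp: gpd_def)
    then show ?thesis using that by (subst gpd_def) simp
  qed
  moreover have "wirt_gen \<alpha> j (wirt_gen \<beta> k (\<lambda>w. u c w vs)) z = wirt_gen \<beta> k (wirt_gen \<alpha> j (\<lambda>w. u c w vs)) z"
    if "c \<in> A" "z \<in> cimage c"
    using that assms by (intro wirt_gen_commute[OF bspec[OF open_cimage]]) (auto simp: gsmooth_def)
  ultimately show "gpd A \<alpha> j (gpd A \<beta> k u) c z vs = gpd A \<beta> k (gpd A \<alpha> j u) c z vs"
    by (cases "c \<in> A \<and> z \<in> cimage c") (auto simp: gpd_def)
qed

lemmas gsmooth_intros = gsmooth_add gsmooth_minus gsmooth_diff gsmooth_sum gsmooth_gwedge gsmooth_gint
  gsmooth_gpd gsmooth_const_form

section \<open>First-order operators built from a coframe\<close>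

lemma gsmooth_ext_deriv: "gsmooth A u \<Longrightarrow> gsmooth A (ext_deriv A E \<alpha> u)"
  unfolding ext_deriv_def by (intro gsmooth_intros)

lemma ext_deriv_zero [simp]: "ext_deriv A E \<alpha> 0 = 0"
  by (simp add: ext_deriv_def)

lemma ext_deriv_add:
  "gsmooth A u \<Longrightarrow> gsmooth A v \<Longrightarrow> ext_deriv A E \<alpha> (u + v) = ext_deriv A E \<alpha> u + ext_deriv A E \<alpha> v"
  by (simp add: ext_deriv_def gpd_add gwedge_add sum.distrib)

lemma ext_deriv_minus: "gsmooth A u \<Longrightarrow> ext_deriv A E \<alpha> (- u) = - ext_deriv A E \<alpha> u"
  by (simp add: ext_deriv_def gpd_minus gwedge_minus sum_negf)

lemma ext_deriv_diff:
  "gsmooth A u \<Longrightarrow> gsmooth A v \<Longrightarrow> ext_deriv A E \<alpha> (u - v) = ext_deriv A E \<alpha> u - ext_deriv A E \<alpha> v"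
  using ext_deriv_add[of u "- v"] gsmooth_minus[of v] by (simp add: ext_deriv_minus)

lemma ext_deriv_sum:
  "(\<And>i. i \<in> I \<Longrightarrow> gsmooth A (f i)) \<Longrightarrow> ext_deriv A E \<alpha> (\<Sum>i\<in>I. f i) = (\<Sum>i\<in>I. ext_deriv A E \<alpha> (f i))"
  by (induction I rule: infinite_finite_induct) (auto simp: ext_deriv_add gsmooth_sum)

text \<open>Moving the covector \<open>E j\<close> past \<open>u\<close> to reach the derivative of
  \<open>v\<close> produces \<open>gsgn u\<close>.\<close>

lemma ext_deriv_gwedge:
  assumes "\<And>j. degree_one (E j)" "gsmooth A u" "gsmooth A v"
  shows "ext_deriv A E \<alpha> (gwedge u v) = gwedge (ext_deriv A E \<alpha> u) v + gwedge (gsgn u) (ext_deriv A E \<alpha> v)"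
proof -
  have "gwedge (const_form (E j)) (gwedge u w) = gwedge (gsgn u) (gwedge (const_form (E j)) w)" for j w
    using gwedge_degree_one_gsgn[OF gdegree_one_const_form[OF assms(1)], of j "gsgn u" w]
    by (simp add: gsgn_simps)
  then show ?thesis
    by (simp add: ext_deriv_def gpd_gwedge assms gwedge_add gwedge_sum gwedge_assoc sum.distrib)
qed

text \<open>The covectors have constant coefficients, so each composite is a double sum in which the
  second derivatives commute and the covectors anticommute.\<close>

lemma ext_deriv_anticommute:
  assumes "\<And>j. degree_one (E j)" "\<And>j. degree_one (F j)" "gsmooth A u"
  shows "ext_deriv A E \<alpha> (ext_deriv A F \<beta> u) = - ext_deriv A F \<beta> (ext_deriv A E \<alpha> u)"
proof -
  have eq: "ext_deriv A E \<alpha> (ext_deriv A F \<beta> u) = (\<Sum>j\<in>UNIV. \<Sum>k\<in>UNIV.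
      gwedge (const_form (E j)) (gwedge (const_form (F k)) (gpd A \<alpha> j (gpd A \<beta> k u))))" for E F \<alpha> \<beta>
    unfolding ext_deriv_def
    using assms(3) by (simp add: gpd_sum gpd_gwedge gwedge_sum gsmooth_gwedge gsmooth_gpd)
  have "gwedge (const_form (E j)) (gwedge (const_form (F k)) w) =
      - gwedge (const_form (F k)) (gwedge (const_form (E j)) w)" for j k and w :: "('a, 'n) gform"
    by (intro gwedge_degree_one_anticommute gdegree_one_const_form assms)
  then show ?thesis
    unfolding eq by (subst sum.swap) (simp only: gpd_commute[OF assms(3), of \<alpha> _ \<beta>] sum_negf)
qed

lemma gint_ext_deriv_dzbar:
  assumes "gsmooth A u"
  shows "gint k (ext_deriv A dzbar \<alpha> u) = - ext_deriv A dzbar \<alpha> (gint k u)"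
  by (simp add: ext_deriv_def gint_sum gint_simps gint_dzbar gpd_gint[OF assms] sum_negf gwedge_minus
      gsgn_degree_one gdegree_one_const_form degree_one_dzbar)

text \<open>By the antiderivation rule the interior product either hits \<open>dz j\<close>, which
  selects the derivative with index \<open>k\<close>, or passes it with a sign. For
  \<open>dzbar\<close> only the second contribution exists.\<close>

lemma gint_ext_deriv_dz:
  assumes "gsmooth A u"
  shows "gint k (ext_deriv A dz \<alpha> u) = gpd A \<alpha> k u - ext_deriv A dz \<alpha> (gint k u)"
  by (simp add: ext_deriv_def gint_sum gint_simps gwedge_gint_dz gpd_gint[OF assms] sum_negf gwedge_minus
      gsgn_degree_one gdegree_one_const_form degree_one_dz sum.distrib sum_subtractf)

end


section \<open>The Lie derivative in a chart\<close>

lemma gscale_simps [simp]: "gscale 1 u = u" "gscale (-1) u = - u"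
  by (auto simp: gscale_def fun_eq_iff)

lemma gsgn_has_degree: "has_degree k u \<Longrightarrow> gsgn u = gscale ((-1) ^ k) u"
  by (intro ext) (metis (no_types, lifting) gscale_def gsgn_def has_degree_def mult_zero_right sgn_form_def)

lemma gwedge_gscale: "gwedge (gscale a u) v = gscale a (gwedge u v)"
  by (intro ext) (simp add: gwedge_def gscale_def wedge_scale_left)

text \<open>The components of a \<open>T\<^sup>1\<^sup>,\<^sup>0\<close>-valued form of type \<open>(0,1)\<close>.\<close>

definition vector_01 :: "('a, 'n::finite) chart set \<Rightarrow> ('n \<Rightarrow> ('a, 'n) gform) \<Rightarrow> bool" where
  "vector_01 A t \<longleftrightarrow> (\<forall>k. gdegree_one (t k) \<and> gsmooth A (t k) \<and> (\<forall>l. gint l (t k) = 0))"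

text \<open>Indexed by components, so that component families such as
  \<open>\<lambda>k. delbar A (p k)\<close> can be contracted directly.\<close>

definition contr_family :: "('n::finite \<Rightarrow> ('a, 'n) gform) \<Rightarrow> ('a, 'n) gform \<Rightarrow> ('a, 'n) gform" where
  "contr_family t u = (\<Sum>k\<in>UNIV. gwedge (t k) (gint k u))"

text \<open>The coordinate formula for the Lie derivative along a (0,1)-form with components
  \<open>t\<close>; \<open>commutator_del_contr_family\<close> identifies it with the
  commutator.\<close>

definition lie_local :: "('a, 'n::finite) chart set \<Rightarrow> ('n \<Rightarrow> ('a, 'n) gform) \<Rightarrow> ('a, 'n) gform \<Rightarrow> ('a, 'n) gform" where
  "lie_local A t u = (\<Sum>k\<in>UNIV. gwedge (del A (t k)) (gint k u) - gwedge (t k) (ddz A k u))"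

text \<open>The consequence of alternation that the bracket formula uses. It passes from
  \<open>u\<close> to \<open>del A u\<close>, as identity (5) requires.\<close>

definition gint_anticommuting :: "('a, 'n::finite) gform \<Rightarrow> bool" where
  "gint_anticommuting u \<longleftrightarrow> (\<forall>j k. gint j (gint k u) = - gint k (gint j u))"

lemma contr_eq_contr_family: "contr \<theta> = contr_family (tcomp \<theta>)"
  by (intro ext) (simp add: contr_def contr_family_def sum_fun_apply gwedge_def gint_def)

context
  fixes A :: "('a, 'n::finite) chart set"
  assumes open_cimage: "\<forall>c\<in>A. open (cimage c)"
begin

lemmas smooth_intros = gsmooth_intros[OF open_cimage] gsmooth_ext_deriv[OF open_cimage]

lemma gsmooth_del: "gsmooth A u \<Longrightarrow> gsmooth A (del A u)"
  unfolding del_eq_ext_deriv by (rule smooth_intros)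

lemma gsmooth_delbar: "gsmooth A u \<Longrightarrow> gsmooth A (delbar A u)"
  unfolding delbar_eq_ext_deriv by (rule smooth_intros)

lemma del_zero [simp]: "del A 0 = 0"
  unfolding del_eq_ext_deriv by (simp add: ext_deriv_def)

lemma del_minus: "gsmooth A u \<Longrightarrow> del A (- u) = - del A u"
  unfolding del_eq_ext_deriv by (rule ext_deriv_minus[OF open_cimage])

lemma del_diff: "gsmooth A u \<Longrightarrow> gsmooth A v \<Longrightarrow> del A (u - v) = del A u - del A v"
  unfolding del_eq_ext_deriv by (rule ext_deriv_diff[OF open_cimage])

lemma delbar_diff: "gsmooth A u \<Longrightarrow> gsmooth A v \<Longrightarrow> delbar A (u - v) = delbar A u - delbar A v"
  unfolding delbar_eq_ext_deriv by (rule ext_deriv_diff[OF open_cimage])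

lemma del_del:
  assumes "gsmooth A u"
  shows "del A (del A u) = 0"
proof -
  have "del A (del A u) = - del A (del A u)"
    unfolding del_eq_ext_deriv
    by (rule ext_deriv_anticommute[OF open_cimage degree_one_dz degree_one_dz assms])
  then show ?thesis by (simp add: fun_eq_iff eq_neg_iff_add_eq_0)
qed

lemma del_delbar: "gsmooth A u \<Longrightarrow> del A (delbar A u) = - delbar A (del A u)"
  unfolding del_eq_ext_deriv delbar_eq_ext_deriv
  by (rule ext_deriv_anticommute[OF open_cimage degree_one_dz degree_one_dzbar])

lemma gint_del: "gsmooth A u \<Longrightarrow> gint k (del A u) = ddz A k u - del A (gint k u)"
  unfolding del_eq_ext_deriv ddz_eq_gpd by (rule gint_ext_deriv_dz[OF open_cimage])

lemma gsmooth_contr_family: "vector_01 A t \<Longrightarrow> gsmooth A u \<Longrightarrow> gsmooth A (contr_family t u)"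
  unfolding contr_family_def vector_01_def by (intro smooth_intros) auto

text \<open>The derivative of a degree-one form is a sum of products of two degree-one forms; the
  two signs from passing \<open>u\<close> cancel.\<close>

lemma gwedge_ext_deriv_degree_one:
  assumes "\<And>j. degree_one (E j)" "gdegree_one a"
  shows "gwedge (ext_deriv A E \<alpha> a) (gwedge u w) = gwedge u (gwedge (ext_deriv A E \<alpha> a) w)"
proof -
  have "gwedge x (gwedge y (gwedge u w)) = gwedge u (gwedge x (gwedge y w))"
    if "gdegree_one x" "gdegree_one y" for x y :: "('a, 'n) gform"
    using that gwedge_degree_one_gsgn by (metis gsgn_simps(2))
  then show ?thesis
    unfolding ext_deriv_def
    by (simp add: gwedge_sum gwedge_assoc gdegree_one_const_form gdegree_one_gpd assms)
qed

lemma gsgn_ext_deriv_degree_one: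
  assumes "\<And>j. degree_one (E j)" "gdegree_one a"
  shows "gsgn (ext_deriv A E \<alpha> a) = ext_deriv A E \<alpha> a"
proof -
  have "gsgn (\<Sum>i\<in>I. f i) = (\<Sum>i\<in>I. gsgn (f i))" for I and f :: "'n \<Rightarrow> ('a, 'n) gform"
    by (intro ext) (simp add: gsgn_def sgn_form_def sum_fun_apply sum_distrib_left)
  then show ?thesis
    unfolding ext_deriv_def
    by (simp add: gsgn_simps gsgn_degree_one gdegree_one_const_form gdegree_one_gpd assms gwedge_minus)
qed

section \<open>Commutators with contraction by one vector-valued form\<close>

context
  fixes p :: "'n \<Rightarrow> ('a, 'n) gform"
  assumes p: "vector_01 A p"
begin

lemma vector_01D: "gdegree_one (p k)" "gsmooth A (p k)" "gint l (p k) = 0"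
  using p by (auto simp: vector_01_def)

lemma gsmooth_lie_local: "gsmooth A u \<Longrightarrow> gsmooth A (lie_local A p u)"
  unfolding lie_local_def ddz_eq_gpd by (intro smooth_intros gsmooth_del vector_01D)

lemma lie_local_sum:
  "(\<And>i. i \<in> I \<Longrightarrow> gsmooth A (f i)) \<Longrightarrow> lie_local A p (\<Sum>i\<in>I. f i) = (\<Sum>i\<in>I. lie_local A p (f i))"
  unfolding lie_local_def ddz_eq_gpd
  by (subst sum.swap) (simp add: gint_sum gpd_sum[OF open_cimage] gwedge_sum sum_subtractf)

lemma lie_local_diff:
  "gsmooth A u \<Longrightarrow> gsmooth A v \<Longrightarrow> lie_local A p (u - v) = lie_local A p u - lie_local A p v"
  unfolding lie_local_def ddz_eq_gpd sum_subtractf[symmetric]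
  by (simp add: gint_simps(3) gpd_diff[OF open_cimage] gwedge_diff algebra_simps)

text \<open>The Leibniz rule applies with odd \<open>p k\<close>. Substituting
  \<open>gint_del\<close> in the second term cancels everything containing
  \<open>del A (gint k u)\<close>.\<close>

lemma commutator_del_contr_family:
  assumes "gsmooth A u"
  shows "del A (contr_family p u) - contr_family p (del A u) = lie_local A p u"
proof -
  have "del A (contr_family p u) = (\<Sum>k\<in>UNIV. del A (gwedge (p k) (gint k u)))"
    unfolding contr_family_def del_eq_ext_deriv
    by (intro ext_deriv_sum[OF open_cimage] smooth_intros vector_01D assms)
  also have "\<dots> = (\<Sum>k\<in>UNIV. gwedge (del A (p k)) (gint k u) - gwedge (p k) (del A (gint k u)))"
    unfolding del_eq_ext_deriv
    by (simp add: ext_deriv_gwedge[OF open_cimage degree_one_dz] vector_01D smooth_intros assms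
        gsgn_degree_one gwedge_minus)
  finally show ?thesis
    by (simp add: contr_family_def lie_local_def gint_del assms gwedge_diff flip: sum_subtractf)
qed

text \<open>Since \<open>gint k\<close> anticommutes with \<open>delbar\<close>, the only surviving
  terms are those with \<open>delbar\<close> on the components.\<close>

lemma commutator_delbar_contr_family:
  assumes "gsmooth A u"
  shows "delbar A (contr_family p u) - contr_family p (delbar A u) = contr_family (\<lambda>k. delbar A (p k)) u"
proof -
  have "delbar A (contr_family p u) = (\<Sum>k\<in>UNIV. delbar A (gwedge (p k) (gint k u)))"
    unfolding contr_family_def delbar_eq_ext_deriv
    by (intro ext_deriv_sum[OF open_cimage] smooth_intros vector_01D assms)
  also have "\<dots> = (\<Sum>k\<in>UNIV. gwedge (delbar A (p k)) (gint k u) - gwedge (p k) (delbar A (gint k u)))"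
    unfolding delbar_eq_ext_deriv
    by (simp add: ext_deriv_gwedge[OF open_cimage degree_one_dzbar] vector_01D smooth_intros assms
        gsgn_degree_one gwedge_minus)
  finally show ?thesis
    unfolding delbar_eq_ext_deriv
    by (simp add: contr_family_def gint_ext_deriv_dzbar[OF open_cimage] assms gwedge_minus
        flip: sum_subtractf)
qed

text \<open>Two sources give the same sign: \<open>gint k\<close> is an antiderivation whose
  prefactor \<open>del A (p k)\<close> is even, while \<open>ddz A k\<close> is a derivation whose
  prefactor \<open>p k\<close> is odd.\<close>

lemma lie_local_gwedge:
  assumes "gsmooth A u" "gsmooth A v"
  shows "lie_local A p (gwedge u v) = gwedge (lie_local A p u) v + gwedge (gsgn u) (lie_local A p v)"
proof -
  have d: "gwedge (del A (p k)) (gwedge (gsgn u) w) = gwedge (gsgn u) (gwedge (del A (p k)) w)" for k w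
    unfolding del_eq_ext_deriv by (rule gwedge_ext_deriv_degree_one[OF degree_one_dz vector_01D(1)])
  have "gwedge (p k) (gwedge u w) = gwedge (gsgn u) (gwedge (p k) w)" for k w
    using gwedge_degree_one_gsgn[OF vector_01D(1), of k "gsgn u" w] by (simp add: gsgn_simps)
  then show ?thesis
    unfolding lie_local_def gwedge_sum sum.distrib[symmetric] ddz_eq_gpd
    by (simp add: gint_simps(4) gpd_gwedge assms gwedge_add gwedge_diff gwedge_assoc d
        add_diff_add)
qed

text \<open>Because \<open>gint m\<close> kills \<open>p k\<close>, it sends
  \<open>del A (p k)\<close> to \<open>ddz A m (p k)\<close>. The other terms cancel: those with two
  interior products by anticommutation, those with derivatives of \<open>u\<close> because
  \<open>p k\<close> is odd.\<close>

lemma gint_lie_local: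
  assumes u: "gsmooth A u" "gint_anticommuting u"
  shows "gint m (lie_local A p u) + lie_local A p (gint m u) = (\<Sum>k\<in>UNIV. gwedge (ddz A m (p k)) (gint k u))"
proof -
  have 1: "gint m (del A (p k)) = ddz A m (p k)" for k
    by (simp add: gint_del vector_01D)
  have 2: "gsgn (del A (p k)) = del A (p k)" for k
    unfolding del_eq_ext_deriv by (rule gsgn_ext_deriv_degree_one[OF degree_one_dz vector_01D(1)])
  have 3: "gint m (gint k u) = - gint k (gint m u)" for k
    using u(2) unfolding gint_anticommuting_def by blast
  have 4: "ddz A k (gint m u) = gint m (ddz A k u)" for k
    unfolding ddz_eq_gpd by (rule gpd_gint[OF u(1)])
  show ?thesis
    unfolding lie_local_def gint_sum sum.distrib[symmetric]
    by (simp add: gint_simps(3,4) 1 2 3 4 vector_01D gsgn_degree_one gwedge_minus)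
qed

end

text \<open>The Leibniz rule for \<open>lie_local A p\<close> on
  \<open>gwedge (t m) (gint m u)\<close> yields derivatives of \<open>t\<close>; its remaining term
  combines with \<open>contr_family t (lie_local A p u)\<close> into the sum of
  \<open>gint_lie_local\<close>, which yields derivatives of \<open>p\<close>.\<close>

lemma commutator_contr_family_lie_local:
  assumes t: "vector_01 A t" and p: "vector_01 A p" and u: "gsmooth A u" "gint_anticommuting u"
  shows "contr_family t (lie_local A p u) - lie_local A p (contr_family t u) =
    contr_family (\<lambda>l. \<Sum>m\<in>UNIV. gwedge (t m) (ddz A m (p l)) + gwedge (p m) (ddz A m (t l))) u"
proof -
  note T = vector_01D[OF t] and P = vector_01D[OF p]
  have lt: "lie_local A p (t m) = - (\<Sum>k\<in>UNIV. gwedge (p k) (ddz A k (t m)))" for m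
    by (simp add: lie_local_def T sum_negf)
  have "lie_local A p (contr_family t u) = (\<Sum>m\<in>UNIV. lie_local A p (gwedge (t m) (gint m u)))"
    unfolding contr_family_def by (intro lie_local_sum[OF p] smooth_intros T u)
  also have "\<dots> = (\<Sum>m\<in>UNIV. - gwedge (\<Sum>k\<in>UNIV. gwedge (p k) (ddz A k (t m))) (gint m u)
      - gwedge (t m) (lie_local A p (gint m u)))"
    by (simp add: lie_local_gwedge[OF p] T u smooth_intros lt gsgn_degree_one gwedge_minus)
  finally have "contr_family t (lie_local A p u) - lie_local A p (contr_family t u) =
    (\<Sum>m\<in>UNIV. gwedge (t m) (gint m (lie_local A p u) + lie_local A p (gint m u))
      + gwedge (\<Sum>k\<in>UNIV. gwedge (p k) (ddz A k (t m))) (gint m u))"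
    by (simp add: contr_family_def gwedge_add algebra_simps flip: sum_subtractf)
  also have "\<dots> = (\<Sum>m\<in>UNIV. \<Sum>k\<in>UNIV. gwedge (t m) (gwedge (ddz A m (p k)) (gint k u)))
      + (\<Sum>m\<in>UNIV. \<Sum>k\<in>UNIV. gwedge (p k) (gwedge (ddz A k (t m)) (gint m u)))"
    by (simp add: gint_lie_local[OF p u] gwedge_sum gwedge_assoc sum.distrib)
  \<comment> \<open>The swap makes the index of the interior product the outer one, as in the other
    double sum, so that both match the contraction.\<close>
  also have "(\<Sum>m\<in>UNIV. \<Sum>k\<in>UNIV. gwedge (t m) (gwedge (ddz A m (p k)) (gint k u))) =
      (\<Sum>k\<in>UNIV. \<Sum>m\<in>UNIV. gwedge (t m) (gwedge (ddz A m (p k)) (gint k u)))"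
    by (rule sum.swap)
  finally show ?thesis
    by (simp only: contr_family_def gwedge_sum gwedge_add gwedge_assoc sum.distrib)
qed

text \<open>Applying \<open>gint_del\<close> twice leaves a difference of derivative terms that
  changes sign when \<open>j\<close> and \<open>k\<close> are exchanged, plus \<open>del\<close> of
  an expression that does so by assumption.\<close>

lemma gint_anticommuting_del:
  assumes "gsmooth A u" "gint_anticommuting u"
  shows "gint_anticommuting (del A u)"
proof -
  have 1: "gint j (gint k (del A u)) = gint j (ddz A k u) - gint k (ddz A j u) + del A (gint j (gint k u))" for j k
    using assms(1) by (simp add: gint_del gint_simps(3) smooth_intros ddz_eq_gpd gpd_gint)
  have 2: "del A (gint j (gint k u)) = - del A (gint k (gint j u))" for j k
    using assms by (metis del_minus gint_anticommuting_def gsmooth_gint[OF open_cimage])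
  show ?thesis
    unfolding gint_anticommuting_def
  proof (intro allI)
    show "gint j (gint k (del A u)) = - gint k (gint j (del A u))" for j k
      unfolding 1[of j k] 1[of k j] 2[of j k] by (simp add: algebra_simps)
  qed
qed

end


section \<open>The identities\<close>

lemma forms_gsmooth: "u \<in> forms A \<Longrightarrow> gsmooth A u"
  by (auto simp: forms_def gsmooth_def)

lemma forms_gint_anticommuting:
  assumes "u \<in> forms A"
  shows "gint_anticommuting u"
proof -
  have *: "int_dz j (int_dz k (u c z)) = - int_dz k (int_dz j (u c z))" for j k c z
  proof (cases "c \<in> A \<and> z \<in> cimage c")
    case True
    then have "alternating (u c z)" using assms by (auto simp: forms_def)
    then show ?thesis by (rule alternating_int_dz_anticommute)
  next
    case False
    then have "u c z = 0" using assms unfolding forms_def by blast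
    then show ?thesis by (simp add: int_dz_def fun_eq_iff)
  qed
  show ?thesis
    unfolding gint_anticommuting_def gint_def by (intro allI ext) (subst *, simp)
qed

text \<open>Type (0,1) means a combination of the covectors \<open>dzbar j\<close>, which have
  degree one and are killed by holomorphic interior products.\<close>

lemma tforms_vector_01:
  assumes "\<theta> \<in> tforms A 1" and "\<forall>c\<in>A. open (cimage c)"
  shows "vector_01 A (tcomp \<theta>)"
proof -
  have "degree_one (tcomp \<theta> k c z) \<and> int_dz l (tcomp \<theta> k c z) = 0" for k l c z
  proof (cases "c \<in> A \<and> z \<in> cimage c")
    case True
    then have "pq_type 0 1 (tcomp \<theta> k c z)" using assms by (auto simp: tforms_def)
    then show ?thesis by (blast intro: pq_type_0_1_degree_one pq_type_0_1_int_dz)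
  next
    case False
    then have "\<theta> c z = 0" using assms(1) unfolding tforms_def by blast
    then show ?thesis by (simp add: tcomp_def int_dz_def degree_one_def fun_eq_iff)
  qed
  moreover have "gsmooth A (tcomp \<theta> k)" for k
    unfolding gsmooth_def tcomp_def
    using assms by (auto simp: tforms_def intro!: smooth_on_bounded_linear[OF _ bounded_linear_vec_nth])
  ultimately show ?thesis
    by (simp add: vector_01_def gdegree_one_def gint_def fun_eq_iff)
qed

lemma contr_family_minus: "contr_family t (- u) = - contr_family t u"
  by (simp add: contr_family_def gint_simps(2) gwedge_minus sum_negf)

lemma contr_family_zero: "contr_family t 0 = 0" "contr_family (\<lambda>k. 0) u = 0"
  by (simp_all add: contr_family_def)

lemma tcomp_delbarT: "tcomp (delbarT A \<theta>) = (\<lambda>k. delbar A (tcomp \<theta> k))"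
  by (intro ext) (simp add: tcomp_def delbarT_def)

lemma tcomp_bracket: "tcomp (bracket A 1 1 \<theta> \<psi>) = (\<lambda>l. \<Sum>m\<in>UNIV.
    gwedge (tcomp \<theta> m) (ddz A m (tcomp \<psi> l)) + gwedge (tcomp \<psi> m) (ddz A m (tcomp \<theta> l)))"
  by (intro ext, subst tcomp_def) (simp add: bracket_def sum_fun_apply)

text \<open>Both arguments are odd, so the bracket is a sum and hence symmetric. This lets the
  second half of (4) follow from the first by exchanging the two forms.\<close>

lemma bracket_commute: "bracket A 1 1 \<theta> \<psi> = bracket A 1 1 \<psi> \<theta>"
  by (simp add: bracket_def add.commute)

theorem lemma4p4:
  fixes X :: "'a topology" and A :: "('a, 'n::finite) chart set"
    and \<theta> \<psi> :: "('a, 'n) tform"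
  assumes "complex_manifold X A"
    and "\<theta> \<in> tforms A 1" and "\<psi> \<in> tforms A 1"
  shows
    "(\<forall>u\<in>forms A. gcomm 1 (lie A 1 \<theta>) 1 (delbar A) u = - gcomm 1 (contr (delbarT A \<theta>)) 1 (del A) u)
   \<and> (delbarT A \<theta> = 0 \<longrightarrow> (\<forall>u\<in>forms A. lie A 1 \<theta> (delbar A u) = - delbar A (lie A 1 \<theta> u)))
   \<and> (\<forall>u\<in>forms A. lie A 1 \<theta> (del A u) = - del A (lie A 1 \<theta> u))
   \<and> (\<forall>k. \<forall>u\<in>forms A. \<forall>v\<in>forms A. has_degree k u \<longrightarrow>
        lie A 1 \<theta> (gwedge u v) = gwedge (lie A 1 \<theta> u) v + gscale ((-1) ^ k) (gwedge u (lie A 1 \<theta> v)))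
   \<and> (\<forall>u\<in>forms A. gcomm 0 (contr \<theta>) 1 (lie A 1 \<psi>) u = - gcomm 1 (lie A 1 \<theta>) 0 (contr \<psi>) u)
   \<and> (\<forall>u\<in>forms A. - gcomm 1 (lie A 1 \<theta>) 0 (contr \<psi>) u = contr (bracket A 1 1 \<theta> \<psi>) u)
   \<and> (\<forall>u\<in>forms A. gcomm 1 (lie A 1 \<theta>) 1 (lie A 1 \<psi>) u = lie A 2 (bracket A 1 1 \<theta> \<psi>) u)"
proof -
  \<comment> \<open>Degrees written as 1 must stay in that form to match the rewriting
    facts.\<close>
  note One_nat_def [simp del]
  have oc: "\<forall>c\<in>A. open (cimage c)"
    using assms(1) by (auto simp: complex_manifold_def)
  note vt = tforms_vector_01[OF assms(2) oc] and vp = tforms_vector_01[OF assms(3) oc]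
  note sm = gsmooth_del[OF oc] gsmooth_delbar[OF oc] gsmooth_contr_family[OF oc vt] gsmooth_contr_family[OF oc vp]
    gsmooth_lie_local[OF oc vt] gsmooth_lie_local[OF oc vp]
  \<comment> \<open>Contraction has degree 0 for a (0,1)-form and degree 1 for a (0,2)-form; hence a
    difference here and a sum in \<open>lie2\<close>.\<close>
  have lie: "lie A 1 \<phi> u = del A (contr \<phi> u) - contr \<phi> (del A u)" for \<phi> u
    by (simp add: lie_def gcomm_def)
  have lie2: "lie A 2 \<phi> u = del A (contr \<phi> u) + contr \<phi> (del A u)" for \<phi> u
    by (simp add: lie_def gcomm_def)
  have lt: "lie A 1 \<theta> u = lie_local A (tcomp \<theta>) u" and lp: "lie A 1 \<psi> u = lie_local A (tcomp \<psi>) u"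
    if "gsmooth A u" for u
    using commutator_del_contr_family[OF oc vt that] commutator_del_contr_family[OF oc vp that]
    by (simp_all only: lie contr_eq_contr_family)
  have sl: "gsmooth A (lie A 1 \<theta> u)" "gsmooth A (lie A 1 \<psi> u)"
    and sc: "gsmooth A (contr \<theta> u)" "gsmooth A (contr \<psi> u)" if "gsmooth A u" for u
    using that by (simp_all add: lt lp sm contr_eq_contr_family)
  have c_minus: "contr \<phi> (- u) = - contr \<phi> u" for \<phi> :: "('a, 'n) tform" and u
    by (simp add: contr_eq_contr_family contr_family_minus)
  have dbar_contr: "contr (delbarT A \<theta>) u = delbar A (contr \<theta> u) - contr \<theta> (delbar A u)"
    if "gsmooth A u" for u
    using commutator_delbar_contr_family[OF oc vt that] by (simp add: contr_eq_contr_family tcomp_delbarT)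
  have c_zero: "contr \<phi> 0 = 0" for \<phi> :: "('a, 'n) tform"
    by (simp add: contr_eq_contr_family contr_family_zero)
  have 1: "gcomm 1 (lie A 1 \<theta>) 1 (delbar A) u = - gcomm 1 (contr (delbarT A \<theta>)) 1 (del A) u"
    if u: "gsmooth A u" for u
  proof -
    have "gcomm 1 (lie A 1 \<theta>) 1 (delbar A) u =
      (del A (contr \<theta> (delbar A u)) - contr \<theta> (del A (delbar A u)))
      + (delbar A (del A (contr \<theta> u)) - delbar A (contr \<theta> (del A u)))"
      using u by (simp add: gcomm_def lie delbar_diff[OF oc] sm sc)
    \<comment> \<open>\<open>del\<close> and \<open>delbar\<close> anticommute on \<open>u\<close>
      and on \<open>contr \<theta> u\<close>; the terms then regroup according to
      \<open>dbar_contr\<close>.\<close>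
    also have "\<dots> = (del A (contr \<theta> (delbar A u)) - (- contr \<theta> (delbar A (del A u))))
      + (- del A (delbar A (contr \<theta> u)) - delbar A (contr \<theta> (del A u)))"
      by (simp only: del_delbar[OF oc u] del_delbar[OF oc sc(1)[OF u]] c_minus minus_minus)
    also have "\<dots> = - ((delbar A (contr \<theta> (del A u)) - contr \<theta> (delbar A (del A u)))
      + (del A (delbar A (contr \<theta> u)) - del A (contr \<theta> (delbar A u))))"
      by (simp add: algebra_simps)
    also have "\<dots> = - gcomm 1 (contr (delbarT A \<theta>)) 1 (del A) u"
      using u by (simp add: gcomm_def dbar_contr del_diff[OF oc] sm sc)
    finally show ?thesis .
  qed
  have 2: "lie A 1 \<theta> (delbar A u) = - delbar A (lie A 1 \<theta> u)" if "gsmooth A u" "delbarT A \<theta> = 0" for u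
  proof -
    have "tcomp (delbarT A \<theta>) = (\<lambda>k. 0)"
      by (intro ext) (simp add: that(2) tcomp_def)
    then have "gcomm 1 (contr (delbarT A \<theta>)) 1 (del A) u = 0"
      by (simp add: gcomm_def contr_eq_contr_family contr_family_zero del_zero[OF oc])
    then have "gcomm 1 (lie A 1 \<theta>) 1 (delbar A) u = 0"
      by (simp only: 1[OF that(1)] minus_zero)
    moreover have "gcomm 1 (lie A 1 \<theta>) 1 (delbar A) u = lie A 1 \<theta> (delbar A u) + delbar A (lie A 1 \<theta> u)"
      by (simp add: gcomm_def)
    ultimately show ?thesis by (simp only: eq_neg_iff_add_eq_0)
  qed
  \<comment> \<open>Since \<open>del\<close> squares to zero, only
    \<open>del A (contr \<phi> (del A u))\<close> survives, with opposite signs on the two sides.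
    Leaving \<phi> general covers both \<theta> and \<psi>.\<close>
  have lie_del: "lie A 1 \<phi> (del A u) = - del A (lie A 1 \<phi> u)"
    if "gsmooth A u" "gsmooth A (contr \<phi> u)" "gsmooth A (contr \<phi> (del A u))" for \<phi> u
    using that by (simp add: lie del_del[OF oc] del_diff[OF oc] c_zero sm)
  have 3: "lie A 1 \<theta> (gwedge u v) = gwedge (lie A 1 \<theta> u) v + gscale ((-1) ^ k) (gwedge u (lie A 1 \<theta> v))"
    if uv: "gsmooth A u" "gsmooth A v" "has_degree k u" for k u v
    unfolding lt[OF uv(1)] lt[OF uv(2)] lt[OF gsmooth_gwedge[OF oc uv(1,2)]] lie_local_gwedge[OF oc vt uv(1,2)]
      gsgn_has_degree[OF uv(3)] gwedge_gscale ..
  have B: "contr \<theta> (lie A 1 \<psi> u) - lie A 1 \<psi> (contr \<theta> u) = contr (bracket A 1 1 \<theta> \<psi>) u" (is ?B1)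
    "contr \<psi> (lie A 1 \<theta> u) - lie A 1 \<theta> (contr \<psi> u) = contr (bracket A 1 1 \<theta> \<psi>) u" (is ?B2)
    if u: "gsmooth A u" "gint_anticommuting u" for u
  proof -
    show ?B1
      unfolding lp[OF u(1)] lp[OF sc(1)[OF u(1)]] unfolding contr_eq_contr_family tcomp_bracket
      by (rule commutator_contr_family_lie_local[OF oc vt vp u])
    show ?B2
      unfolding bracket_commute[of A \<theta> \<psi>] lt[OF u(1)] lt[OF sc(2)[OF u(1)]]
      unfolding contr_eq_contr_family tcomp_bracket
      by (rule commutator_contr_family_lie_local[OF oc vp vt u])
  qed
  have lie_diff: "lie A 1 \<psi> (x - y) = lie A 1 \<psi> x - lie A 1 \<psi> y" if "gsmooth A x" "gsmooth A y" for x y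
    unfolding lp[OF that(1)] lp[OF that(2)] lp[OF gsmooth_diff[OF oc that]] by (rule lie_local_diff[OF oc vp that])
  have 5: "gcomm 1 (lie A 1 \<theta>) 1 (lie A 1 \<psi>) u = lie A 2 (bracket A 1 1 \<theta> \<psi>) u"
    if u: "gsmooth A u" "gint_anticommuting u" for u
  proof -
    have du: "gsmooth A (del A u)" "gint_anticommuting (del A u)"
      using u by (simp_all add: sm gint_anticommuting_del[OF oc])
    \<comment> \<open>Contraction with the bracket is replaced by the commutator from
      \<open>B\<close>, both at \<open>u\<close> and at \<open>del A u\<close>. Moving
      \<open>del\<close> through the Lie derivative along \<psi> then groups the terms into the
      graded commutator.\<close>
    have "lie A 2 (bracket A 1 1 \<theta> \<psi>) u =
      (del A (contr \<theta> (lie A 1 \<psi> u)) - del A (lie A 1 \<psi> (contr \<theta> u)))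
      + (contr \<theta> (lie A 1 \<psi> (del A u)) - lie A 1 \<psi> (contr \<theta> (del A u)))"
      unfolding lie2 B(1)[OF u, symmetric] B(1)[OF du, symmetric]
      by (simp only: del_diff[OF oc] sl sc u)
    also have "\<dots> = (del A (contr \<theta> (lie A 1 \<psi> u)) + lie A 1 \<psi> (del A (contr \<theta> u)))
      + (- contr \<theta> (del A (lie A 1 \<psi> u)) - lie A 1 \<psi> (contr \<theta> (del A u)))"
      by (simp add: lie_del[OF u(1)] lie_del[OF sc(1)[OF u(1)]] sc sm u(1) c_minus)
    also have "\<dots> = (del A (contr \<theta> (lie A 1 \<psi> u)) - contr \<theta> (del A (lie A 1 \<psi> u)))
      + lie A 1 \<psi> (del A (contr \<theta> u) - contr \<theta> (del A u))"
      by (simp add: lie_diff sc sm u(1) algebra_simps)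
    also have "\<dots> = gcomm 1 (lie A 1 \<theta>) 1 (lie A 1 \<psi>) u"
      by (simp add: gcomm_def lie[of \<theta>])
    finally show ?thesis by (rule sym)
  qed
  have 4: "gcomm 0 (contr \<theta>) 1 (lie A 1 \<psi>) u = contr (bracket A 1 1 \<theta> \<psi>) u"
    "- gcomm 1 (lie A 1 \<theta>) 0 (contr \<psi>) u = contr (bracket A 1 1 \<theta> \<psi>) u"
    if "gsmooth A u" "gint_anticommuting u" for u
  proof -
    have "gcomm 0 (contr \<theta>) 1 (lie A 1 \<psi>) u = contr \<theta> (lie A 1 \<psi> u) - lie A 1 \<psi> (contr \<theta> u)"
      by (simp add: gcomm_def)
    then show "gcomm 0 (contr \<theta>) 1 (lie A 1 \<psi>) u = contr (bracket A 1 1 \<theta> \<psi>) u"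
      using B(1)[OF that] by (rule trans)
    have "- gcomm 1 (lie A 1 \<theta>) 0 (contr \<psi>) u = contr \<psi> (lie A 1 \<theta> u) - lie A 1 \<theta> (contr \<psi> u)"
      by (simp add: gcomm_def)
    then show "- gcomm 1 (lie A 1 \<theta>) 0 (contr \<psi>) u = contr (bracket A 1 1 \<theta> \<psi>) u"
      using B(2)[OF that] by (rule trans)
  qed
  have lie_del_\<theta>: "lie A 1 \<theta> (del A u) = - del A (lie A 1 \<theta> u)" if "gsmooth A u" for u
    by (rule lie_del[OF that]) (simp_all add: sc sm that)
  note F = forms_gsmooth forms_gint_anticommuting
  show ?thesis
    \<comment> \<open>The identities were shown for smooth families, with anticommuting interior
      products where needed; \<open>F\<close> supplies these properties for global forms.\<close>
    by (intro conjI ballI allI impI 1 2 3 4(2) 5 lie_del_\<theta> trans[OF 4(1) 4(2)[symmetric]] F)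
qed

end
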